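(* Let $\mu$ be a symmetric Borel probability measure on $\mathbb{R}$. The following conditions are equivalent: (a) there exist $h>0$ and $\lambda\in[0,1)$ such that $\mu\in\mathcal{M}(h,\lambda)$; (b) there exists $C_p>0$ such that $\mu$ satisfies the convex Poincaré inequality with constant $C_p$; (c) there exists $C_\tau>0$ such that $\mu$ satisfies the convex exponential property $(\tau)$ with constant $C_\tau$. Moreover: if $\mu\in\mathcal{M}(h,\lambda)$ then $\mu$ satisfies the convex exponential property $(\tau)$ with constant $C_\tau=17h/(1-\lambda)^2$; if $\mu$ satisfies the convex exponential property $(\tau)$ with constant $C_\tau$ then it satisfies the convex Poincaré inequality with constant $C_p=\tfrac12 C_\tau^2$; and if $\mu$ satisfies the convex Poincaré inequality with constant $C_p$ then $\mu\in\mathcal{M}(\sqrt{8C_p},1/2)$.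
   Context: For $h>0$, $\lambda\in[0,1)$, $\mathcal{M}(h,\lambda)$ denotes the class of symmetric Borel probability measures $\mu$ on $\mathbb{R}$ such that $\mu([x+h,\infty))\le\lambda\,\mu([x,\infty))$ for all $x\ge0$. For a locally Lipschitz $f:\mathbb{R}\to\mathbb{R}$ (in particular a convex $f$), $f'(x):=\limsup_{h\to0}\frac{f(x+h)-f(x)}{h}$. A Borel probability measure $\mu$ on $\mathbb{R}$ satisfies the convex Poincaré inequality with constant $C_p$ if for every convex $f:\mathbb{R}\to\mathbb{R}$ with $f'$ bounded, $\mathrm{Var}_\mu f\le C_p\int (f')^2\,d\mu$. Let $\varphi_0(x)=\frac12x^2$ for $|x|\le1$ and $\varphi_0(x)=|x|-\frac12$ for $|x|>1$. The infimum convolution is $(f\,\square\,\varphi)(x)=\inf_{y}\{f(y)+\varphi(x-y)\}$. A Borel probability measure $\mu$ on $\mathbb{R}$ satisfies the convex exponential property $(\tau)$ with constant $C_\tau>0$ if for every convex $f:\mathbb{R}\to\mathbb{R}$ with $\inf f>-\infty$, $\left(\int e^{f\square\varphi}\,d\mu\right)\left(\int e^{-f}\,d\mu\right)\le1$, where $\varphi(x)=\varphi_0(x/C_\tau)$. *)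

theory Defs
  imports "HOL-Probability.Probability"
begin

definition symmetric_measure :: "real measure \<Rightarrow> bool" where
  "symmetric_measure \<mu> \<longleftrightarrow>
     (\<forall>A \<in> sets borel. measure \<mu> (uminus ` A) = measure \<mu> A)"

definition in_class_M :: "real measure \<Rightarrow> real \<Rightarrow> real \<Rightarrow> bool" where
  "in_class_M \<mu> h lam \<longleftrightarrow> h > 0 \<and> 0 \<le> lam \<and> lam < 1 \<and> symmetric_measure \<mu> \<and>
     (\<forall>x\<ge>0. measure \<mu> {x + h..} \<le> lam * measure \<mu> {x..})"

text \<open>f'(x) = limsup_{h -> 0} (f(x+h) - f(x))/h (finite for convex f).\<close>
definition ls_deriv :: "(real \<Rightarrow> real) \<Rightarrow> real \<Rightarrow> real" where
  "ls_deriv f x = real_of_ereal (Limsup (at 0) (\<lambda>h. ereal ((f (x + h) - f x) / h)))"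

text \<open>Convex Poincare inequality with constant Cp. The variance of a non-square-integrable
  function is infinite, so the inequality requires square integrability.\<close>
definition convex_poincare :: "real measure \<Rightarrow> real \<Rightarrow> bool" where
  "convex_poincare \<mu> Cp \<longleftrightarrow>
     (\<forall>f. convex_on UNIV f \<and> (\<exists>B. \<forall>x. \<bar>ls_deriv f x\<bar> \<le> B) \<longrightarrow>
        integrable \<mu> (\<lambda>x. (f x)\<^sup>2) \<and>
        (\<integral>x. (f x - (\<integral>y. f y \<partial>\<mu>))\<^sup>2 \<partial>\<mu>) \<le> Cp * (\<integral>x. (ls_deriv f x)\<^sup>2 \<partial>\<mu>))"

definition phi0 :: "real \<Rightarrow> real" where
  "phi0 x = (if \<bar>x\<bar> \<le> 1 then x\<^sup>2 / 2 else \<bar>x\<bar> - 1 / 2)"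

definition inf_conv :: "(real \<Rightarrow> real) \<Rightarrow> (real \<Rightarrow> real) \<Rightarrow> real \<Rightarrow> real" where
  "inf_conv f \<phi> x = (INF y. f y + \<phi> (x - y))"

definition convex_tau :: "real measure \<Rightarrow> real \<Rightarrow> bool" where
  "convex_tau \<mu> Ct \<longleftrightarrow>
     (\<forall>f. convex_on UNIV f \<and> bdd_below (range f) \<longrightarrow>
        (\<integral>\<^sup>+ x. ennreal (exp (inf_conv f (\<lambda>z. phi0 (z / Ct)) x)) \<partial>\<mu>) *
        (\<integral>\<^sup>+ x. ennreal (exp (- f x)) \<partial>\<mu>) \<le> 1)"

end

theory Submission
  imports Defs
begin

text \<open>
  Tails to tau. Put \<open>\<delta> = 1 - \<lambda>\<close> and \<open>C = 17 h / \<delta>\<^sup>2\<close>. Since the cost is the infimum convolution of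
  \<open>x\<^sup>2 / 2\<close> with \<open>\<bar>x\<bar>\<close>, one may replace \<open>f\<close> by its largest \<open>1 / C\<close>-Lipschitz minorant and normalise
  it by \<open>f 0 = 0\<close>. By convexity the infimum convolution then drops below \<open>f\<close> by at least
  \<open>(C / h - 1 / 2) D\<^sup>2\<close>, where \<open>D\<close> is the increment of the positive part of \<open>f\<close> over a step of length
  \<open>h\<close> away from the origin. By the inequality between arithmetic and geometric means it suffices
  that the two integrals add up to at most 2, which reduces to bounding the integral of
  \<open>exp f + exp (- f) - 2\<close> by that of \<open>D\<^sup>2 exp f\<close>. The tail condition says that shifting a
  nondecreasing function on the half-line by \<open>h\<close> multiplies its integral by at most \<open>\<lambda>\<close>; this gives
  the bound for the positive part of \<open>f\<close> on each half-line. Convexity and \<open>f 0 = 0\<close> give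
  \<open>- f x \<le> f (- x)\<close>, so by symmetry of the measure the negative part costs at most a factor 2.

  Tau to Poincare. Apply tau to \<open>\<epsilon> f\<close>, bound the infimum convolution from below with the
  subgradient inequality, and compare second-order terms as \<open>\<epsilon>\<close> tends to 0.

  Poincare to tails. Test with \<open>max 0 (x - a)\<close>, which vanishes with probability at least 1/2.
\<close>

subsection \<open>Convex functions on the line\<close>

lemma convex_on_chord:
  fixes f :: "real \<Rightarrow> real"
  assumes "convex_on UNIV f" "0 \<le> t" "t \<le> 1"
  shows "f (x + t * m) - f x \<le> t * (f (x + m) - f x)"
proof -
  have "f ((1 - t) *\<^sub>R x + t *\<^sub>R (x + m)) \<le> (1 - t) * f x + t * f (x + m)"
    using assms by (intro convex_onD) auto
  moreover have "(1 - t) *\<^sub>R x + t *\<^sub>R (x + m) = x + t * m"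
    by (simp add: algebra_simps)
  ultimately show ?thesis by (simp add: algebra_simps)
qed

lemma convex_on_slope_mono:
  fixes f :: "real \<Rightarrow> real"
  assumes f: "convex_on UNIV f" and "h \<le> k" "h \<noteq> 0" "k \<noteq> 0"
  shows "(f (x + h) - f x) / h \<le> (f (x + k) - f x) / k"
proof -
  consider "0 < h" | "k < 0" | "h < 0" "0 < k" using assms by linarith
  then show ?thesis
  proof cases
    case 1
    then have "f (x + h) - f x \<le> (h / k) * (f (x + k) - f x)"
      using convex_on_chord[OF f, of "h / k" x k] assms by simp
    then show ?thesis using 1 assms by (simp add: field_simps)
  next
    case 2
    then have "f (x + k) - f x \<le> (k / h) * (f (x + h) - f x)"
      using convex_on_chord[OF f, of "k / h" x h] assms by (simp add: field_simps)
    then have "(k / h) * (f (x + h) - f x) / k \<le> (f (x + k) - f x) / k"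
      using 2 by (intro divide_right_mono_neg) auto
    then show ?thesis using 2 assms by simp
  next
    case 3
    \<comment> \<open>Since \<open>h < 0 < k\<close>, the point \<open>x\<close> lies between
      \<open>x + k\<close> and \<open>x + h\<close>; \<open>t\<close> is the fraction of the way
      from the former at which it sits.\<close>
    define t where "t = k / (k - h)"
    have t: "0 \<le> t" "t \<le> 1" using 3 by (auto simp: t_def)
    have "(x + k) + t * (h - k) = x" "(x + k) + (h - k) = x + h"
      using 3 by (simp_all add: t_def field_simps)
    then have "f x - f (x + k) \<le> t * (f (x + h) - f (x + k))"
      using convex_on_chord[OF f t, of "x + k" "h - k"] by metis
    then have "(k - h) * (f x - f (x + k)) \<le> (k - h) * (t * (f (x + h) - f (x + k)))"
      using 3 by (intro mult_left_mono) auto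
    also have "\<dots> = k * (f (x + h) - f (x + k))" using 3 by (simp add: t_def)
    finally have "(f (x + k) - f x) * h \<le> (f (x + h) - f x) * k" by (simp add: algebra_simps)
    then show ?thesis using 3 by (simp add: field_simps)
  qed
qed

lemma convex_on_abs_div:
  assumes "0 < C"
  shows "convex_on UNIV (\<lambda>z::real. \<bar>z\<bar> / C)"
proof (rule convex_onI)
  fix t x y :: real assume "0 < t" "t < 1"
  then have "\<bar>(1 - t) * x + t * y\<bar> \<le> (1 - t) * \<bar>x\<bar> + t * \<bar>y\<bar>"
    using abs_triangle_ineq[of "(1 - t) * x" "t * y"] by (simp add: abs_mult)
  then show "\<bar>(1 - t) *\<^sub>R x + t *\<^sub>R y\<bar> / C \<le> (1 - t) * (\<bar>x\<bar> / C) + t * (\<bar>y\<bar> / C)"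
    using assms by (simp add: divide_right_mono flip: add_divide_distrib)
qed auto

text \<open>Difference quotients of a convex function increase with the step, so the upper limit at
  0 lies between every left quotient and every right quotient. Clearing denominators in this
  sandwich gives the claim.\<close>

lemma ls_deriv_subgradient:
  assumes f: "convex_on UNIV f"
  shows "f x + ls_deriv f x * (y - x) \<le> f y"
proof -
  define q where "q h = (f (x + h) - f x) / h" for h
  define L where "L = Limsup (at 0) (\<lambda>h. ereal (q h))"
  have upper: "L \<le> ereal (q k)" if "k > 0" for k
  proof -
    have "eventually (\<lambda>h. h \<noteq> 0 \<and> h < k) (at (0::real))"
      using that by (auto simp: eventually_at intro!: exI[of _ k])
    then have "eventually (\<lambda>h. ereal (q h) \<le> ereal (q k)) (at 0)"
      unfolding q_def by eventually_elim (use convex_on_slope_mono[OF f] that in auto)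
    then show ?thesis unfolding L_def by (intro Limsup_bounded)
  qed
  have lower: "ereal (q k) \<le> L" if "k < 0" for k
  proof -
    have "eventually (\<lambda>h. h \<noteq> 0 \<and> k < h) (at (0::real))"
      using that by (auto simp: eventually_at dist_real_def intro!: exI[of _ "- k"])
    then have "eventually (\<lambda>h. ereal (q k) \<le> ereal (q h)) (at 0)"
      unfolding q_def by eventually_elim (use convex_on_slope_mono[OF f] that in auto)
    then show ?thesis unfolding L_def by (intro le_Limsup) auto
  qed
  \<comment> \<open>Finiteness matters because \<open>real_of_ereal\<close> sends infinite values to
    0.\<close>
  have "L \<noteq> \<infinity>" "L \<noteq> -\<infinity>" using upper[of 1] lower[of "-1"] by auto
  then obtain l where l: "L = ereal l" by (cases L) auto
  have ls: "ls_deriv f x = l" unfolding ls_deriv_def using l by (simp add: L_def q_def)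
  consider "y = x" | "y > x" | "y < x" by linarith
  then show ?thesis
  proof cases
    case 2
    then have "l \<le> q (y - x)" using upper[of "y - x"] l by simp
    then show ?thesis using 2 by (simp add: q_def ls field_simps)
  next
    case 3
    then have "q (y - x) \<le> l" using lower[of "y - x"] l by simp
    then show ?thesis using 3 by (simp add: q_def ls field_simps)
  qed simp
qed

text \<open>Add the subgradient inequalities at \<open>x\<close> and at \<open>y\<close>.
  Monotonicity later makes the derivative Borel measurable.\<close>

lemma mono_ls_deriv:
  assumes "convex_on UNIV f"
  shows "mono (ls_deriv f)"
proof (rule monoI)
  fix x y :: real assume "x \<le> y"
  show "ls_deriv f x \<le> ls_deriv f y"
  proof (cases "x = y")
    case False
    with \<open>x \<le> y\<close> have "x < y" by simp
    moreover have "(ls_deriv f x - ls_deriv f y) * (y - x) \<le> 0"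
      using ls_deriv_subgradient[OF assms, of x y] ls_deriv_subgradient[OF assms, of y x]
      by (simp add: algebra_simps)
    ultimately show ?thesis by (simp add: mult_le_0_iff)
  qed simp
qed

lemma lipschitz_of_bounded_ls_deriv:
  assumes f: "convex_on UNIV f" and B: "\<And>x. \<bar>ls_deriv f x\<bar> \<le> B"
  shows "\<bar>f y - f x\<bar> \<le> B * \<bar>y - x\<bar>"
proof -
  have *: "f x - f y \<le> B * \<bar>y - x\<bar>" for x y
  proof -
    have "f x - f y \<le> - (ls_deriv f x * (y - x))" using ls_deriv_subgradient[OF f, of x y] by simp
    also have "\<dots> \<le> \<bar>ls_deriv f x\<bar> * \<bar>y - x\<bar>" by (simp flip: abs_mult)
    also have "\<dots> \<le> B * \<bar>y - x\<bar>" using B by (intro mult_right_mono) auto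
    finally show ?thesis .
  qed
  show ?thesis using *[of x y] *[of y x] by (simp add: abs_le_iff abs_minus_commute)
qed

subsection \<open>Infimum convolution with the Huber cost\<close>

lemma phi0_nonneg: "0 \<le> phi0 x"
  by (auto simp: phi0_def)

lemma phi0_le_square: "phi0 x \<le> x\<^sup>2 / 2"
proof (cases "\<bar>x\<bar> \<le> 1")
  case False
  have "0 \<le> (\<bar>x\<bar> - 1)\<^sup>2" by simp
  then have "2 * \<bar>x\<bar> \<le> x\<^sup>2 + 1" by (simp add: power2_diff)
  then show ?thesis using False by (simp add: phi0_def)
qed (simp add: phi0_def)

lemma abs_le_phi0: "\<bar>x\<bar> - 1 / 2 \<le> phi0 x"
proof (cases "\<bar>x\<bar> \<le> 1")
  case True
  have "0 \<le> (\<bar>x\<bar> - 1)\<^sup>2" by simp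
  then have "2 * \<bar>x\<bar> \<le> x\<^sup>2 + 1" by (simp add: power2_diff)
  then show ?thesis using True by (simp add: phi0_def)
qed (simp add: phi0_def)

text \<open>The Legendre transform of the cost is half the square on the unit interval.\<close>

lemma phi0_ge_affine:
  assumes "\<bar>p\<bar> \<le> 1"
  shows "p * x - p\<^sup>2 / 2 \<le> phi0 x"
proof (cases "\<bar>x\<bar> \<le> 1")
  case True
  have "0 \<le> (x - p)\<^sup>2" by simp
  then show ?thesis using True by (simp add: phi0_def power2_diff algebra_simps)
next
  case False
  have "(\<bar>p\<bar> - 1) * (2 * \<bar>x\<bar> - 1 - \<bar>p\<bar>) \<le> 0"
    using assms False by (intro mult_nonpos_nonneg) auto
  then have "\<bar>p\<bar> * \<bar>x\<bar> - \<bar>p\<bar> ^ 2 / 2 \<le> \<bar>x\<bar> - 1 / 2"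
    by (simp add: algebra_simps power2_eq_square)
  moreover have "p * x \<le> \<bar>p\<bar> * \<bar>x\<bar>" by (simp flip: abs_mult)
  ultimately show ?thesis using False by (simp add: phi0_def)
qed

lemma phi0_add_le: "phi0 (x + y) \<le> phi0 x + \<bar>y\<bar>"
proof -
  \<comment> \<open>This clamp is the slope of \<open>phi0\<close> at \<open>x + y\<close>; there
    the affine minorant of slope \<open>p\<close> touches the cost, while at \<open>x\<close> it
    stays below.\<close>
  define p where "p = max (-1) (min 1 (x + y))"
  have p: "\<bar>p\<bar> \<le> 1" by (simp add: p_def)
  have "phi0 (x + y) = p * (x + y) - p\<^sup>2 / 2"
    by (auto simp: phi0_def p_def max_def min_def power2_eq_square)
  also have "\<dots> = (p * x - p\<^sup>2 / 2) + p * y" by (simp add: algebra_simps)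
  also have "\<dots> \<le> phi0 x + \<bar>p\<bar> * \<bar>y\<bar>"
    using phi0_ge_affine[OF p, of x] by (intro add_mono) (auto simp flip: abs_mult)
  also have "\<dots> \<le> phi0 x + 1 * \<bar>y\<bar>" using p by (intro add_left_mono mult_right_mono) auto
  finally show ?thesis by simp
qed

text \<open>A real \<open>INF\<close> is sure to be a lower bound only when its range is bounded
  below, which is why a lower bound \<open>m\<close> for \<open>f\<close> and a nonnegative cost are
  carried along.\<close>

lemma bdd_below_inf_conv:
  assumes "\<And>y. m \<le> f y" "\<And>z. (0::real) \<le> \<phi> z"
  shows "bdd_below (range (\<lambda>y. f y + \<phi> (x - y)))"
  using assms by (intro bdd_belowI[of _ m]) (auto intro!: add_increasing2)

lemma inf_conv_lower:
  assumes "\<And>y. m \<le> f y" "\<And>z. (0::real) \<le> \<phi> z"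
  shows "inf_conv f \<phi> x \<le> f y + \<phi> (x - y)"
  unfolding inf_conv_def by (intro cINF_lower bdd_below_inf_conv[of m] assms) auto

lemma le_inf_conv:
  assumes "\<And>y. c \<le> f y + \<phi> (x - y)"
  shows "c \<le> inf_conv f \<phi> x"
  unfolding inf_conv_def by (intro cINF_greatest assms) auto

text \<open>The convex combination of a competitor \<open>a\<close> at \<open>x\<close> and a
  competitor \<open>b\<close> at \<open>y\<close> competes at the combined point.\<close>

lemma convex_on_inf_conv:
  assumes f: "convex_on UNIV f" "\<And>y. m \<le> f y" and \<phi>: "convex_on UNIV \<phi>" "\<And>z. (0::real) \<le> \<phi> z"
  shows "convex_on UNIV (inf_conv f \<phi>)"
proof (rule convex_onI)
  fix t x y :: real assume t: "0 < t" "t < 1"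
  let ?Q = "inf_conv f \<phi>"
  have step: "?Q ((1 - t) * x + t * y) \<le> (1 - t) * (f a + \<phi> (x - a)) + t * (f b + \<phi> (y - b))" for a b
  proof -
    have "?Q ((1 - t) * x + t * y)
        \<le> f ((1 - t) * a + t * b) + \<phi> (((1 - t) * x + t * y) - ((1 - t) * a + t * b))"
      by (rule inf_conv_lower[of m]) (use f \<phi> in auto)
    also have "((1 - t) * x + t * y) - ((1 - t) * a + t * b) = (1 - t) * (x - a) + t * (y - b)"
      by (simp add: algebra_simps)
    also have "f ((1 - t) * a + t * b) + \<phi> ((1 - t) * (x - a) + t * (y - b))
        \<le> ((1 - t) * f a + t * f b) + ((1 - t) * \<phi> (x - a) + t * \<phi> (y - b))"
      using convex_onD[OF f(1), of t a b] convex_onD[OF \<phi>(1), of t "x - a" "y - b"] t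
      by (intro add_mono) auto
    finally show ?thesis by (simp add: algebra_simps)
  qed
  \<comment> \<open>Solving for the term in \<open>a\<close> lets the infimum over \<open>a\<close>
    be taken with \<open>b\<close> fixed; the same rearrangement then handles
    \<open>b\<close>.\<close>
  have "(?Q ((1 - t) * x + t * y) - t * (f b + \<phi> (y - b))) / (1 - t) \<le> ?Q x" for b
    by (rule le_inf_conv) (use step[of _ b] t in \<open>simp add: field_simps\<close>)
  then have "?Q ((1 - t) * x + t * y) \<le> (1 - t) * ?Q x + t * (f b + \<phi> (y - b))" for b
    using t by (simp add: field_simps)
  then have "(?Q ((1 - t) * x + t * y) - (1 - t) * ?Q x) / t \<le> ?Q y"
    using t by (intro le_inf_conv) (simp add: field_simps)
  then show "?Q ((1 - t) *\<^sub>R x + t *\<^sub>R y) \<le> (1 - t) * ?Q x + t * ?Q y"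
    using t by (simp add: field_simps)
qed auto

lemma inf_conv_abs_lipschitz:
  assumes f: "\<And>y. m \<le> f y" and C: "C > 0"
  shows "\<bar>inf_conv f (\<lambda>z. \<bar>z\<bar> / C) y - inf_conv f (\<lambda>z. \<bar>z\<bar> / C) x\<bar> \<le> \<bar>y - x\<bar> / C"
proof -
  let ?Q = "inf_conv f (\<lambda>z. \<bar>z\<bar> / C)"
  have *: "?Q y - \<bar>y - x\<bar> / C \<le> ?Q x" for x y
  proof (rule le_inf_conv)
    fix a
    have "?Q y \<le> f a + \<bar>y - a\<bar> / C" by (rule inf_conv_lower[of m]) (use f C in auto)
    also have "\<bar>y - a\<bar> / C \<le> \<bar>y - x\<bar> / C + \<bar>x - a\<bar> / C"
      using C by (simp flip: add_divide_distrib add: divide_right_mono)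
    finally show "?Q y - \<bar>y - x\<bar> / C \<le> f a + \<bar>x - a\<bar> / C" by simp
  qed
  show ?thesis using *[of x y] *[of y x] by (simp add: abs_le_iff abs_minus_commute)
qed

text \<open>Half of the decomposition of the Huber cost: going from \<open>x\<close> to
  \<open>y\<close> at quadratic price and on to the competitor at linear price is never cheaper than
  going directly.\<close>

lemma inf_conv_phi0_le:
  assumes f: "\<And>y. m \<le> f y" and C: "C > 0"
  shows "inf_conv f (\<lambda>z. phi0 (z / C)) x \<le> inf_conv f (\<lambda>z. \<bar>z\<bar> / C) y + ((x - y) / C)\<^sup>2 / 2"
proof -
  have "inf_conv f (\<lambda>z. phi0 (z / C)) x - ((x - y) / C)\<^sup>2 / 2 \<le> inf_conv f (\<lambda>z. \<bar>z\<bar> / C) y"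
  proof (rule le_inf_conv)
    fix a
    have "inf_conv f (\<lambda>z. phi0 (z / C)) x \<le> f a + phi0 ((x - a) / C)"
      by (rule inf_conv_lower[of m]) (use f in \<open>auto simp: phi0_nonneg\<close>)
    also have "(x - a) / C = (x - y) / C + (y - a) / C" by (simp add: diff_divide_distrib)
    also have "phi0 \<dots> \<le> ((x - y) / C)\<^sup>2 / 2 + \<bar>(y - a) / C\<bar>"
      using phi0_add_le[of "(x - y) / C" "(y - a) / C"] phi0_le_square[of "(x - y) / C"] by simp
    finally show "inf_conv f (\<lambda>z. phi0 (z / C)) x - ((x - y) / C)\<^sup>2 / 2 \<le> f a + \<bar>y - a\<bar> / C"
      using C by simp
  qed
  then show ?thesis by simp
qed

text \<open>Go a fraction \<open>t\<close> of the way from \<open>x\<close> to \<open>z\<close>: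
  convexity lowers \<open>Q\<close> by at least \<open>t * d\<close>, and the quadratic price is at
  most \<open>(t * h / C)\<^sup>2 / 2\<close>.\<close>

lemma inf_conv_phi0_descent:
  assumes f: "convex_on UNIV f" "\<And>y. m \<le> f y" and h: "0 < h" "0 < C"
    and Q: "Q = inf_conv f (\<lambda>z. \<bar>z\<bar> / C)"
    and z: "\<bar>x - z\<bar> \<le> h" and d: "0 \<le> d" "d \<le> Q x - Q z" "d \<le> h / C"
  shows "inf_conv f (\<lambda>z. phi0 (z / C)) x \<le> Q x - (C / h - 1 / 2) * d\<^sup>2"
proof -
  \<comment> \<open>This choice makes the gain \<open>C / h * d\<^sup>2\<close> and the price at
    most \<open>d\<^sup>2 / 2\<close>; the bound \<open>d \<le> h / C\<close> keeps
    \<open>t \<le> 1\<close>.\<close>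
  define t where "t = d * C / h"
  have t: "0 \<le> t" "t \<le> 1" using d h by (auto simp: t_def field_simps)
  have Q_convex: "convex_on UNIV Q"
    unfolding Q using f h by (intro convex_on_inf_conv[of f m] convex_on_abs_div) auto
  have "inf_conv f (\<lambda>z. phi0 (z / C)) x
      \<le> Q (x + t * (z - x)) + ((x - (x + t * (z - x))) / C)\<^sup>2 / 2"
    unfolding Q by (rule inf_conv_phi0_le[of m]) (use f h in auto)
  also have "Q (x + t * (z - x)) \<le> Q x - t * d"
  proof -
    have "Q (x + t * (z - x)) - Q x \<le> t * (Q z - Q x)"
      using convex_on_chord[OF Q_convex t, of x "z - x"] by simp
    also have "\<dots> \<le> t * (- d)" using d t by (intro mult_left_mono) auto
    finally show ?thesis by simp
  qed
  also have "((x - (x + t * (z - x))) / C)\<^sup>2 \<le> (t * h / C)\<^sup>2"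
  proof (rule power2_le_iff_abs_le[THEN iffD2])
    show "0 \<le> t * h / C" using t h by simp
    have "t * \<bar>x - z\<bar> \<le> t * h" using z t by (intro mult_left_mono) auto
    moreover have "\<bar>(x - (x + t * (z - x))) / C\<bar> = t * \<bar>x - z\<bar> / C"
      using t h by (simp add: abs_mult abs_minus_commute)
    ultimately show "\<bar>(x - (x + t * (z - x))) / C\<bar> \<le> t * h / C"
      using h by (simp add: divide_right_mono)
  qed
  also have "Q x - t * d + (t * h / C)\<^sup>2 / 2 = Q x - (C / h - 1 / 2) * d\<^sup>2"
    using h by (simp add: t_def field_simps power2_eq_square)
  finally show ?thesis by simp
qed

section \<open>Continuity and measurability of Lipschitz functions\<close>

lemma continuous_on_of_lipschitz:
  fixes f :: "real \<Rightarrow> real"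
  assumes "\<And>x y. \<bar>f y - f x\<bar> \<le> L * \<bar>y - x\<bar>"
  shows "continuous_on UNIV f"
proof -
  have "L-lipschitz_on UNIV f"
  proof (rule lipschitz_onI)
    show "0 \<le> L" using order_trans[OF abs_ge_zero assms[of 1 0]] by simp
  qed (use assms in \<open>auto simp: dist_real_def\<close>)
  then show ?thesis by (rule lipschitz_on_continuous_on)
qed

lemma borel_measurable_of_lipschitz:
  fixes f :: "real \<Rightarrow> real"
  assumes "\<And>x y. \<bar>f y - f x\<bar> \<le> L * \<bar>y - x\<bar>"
  shows "f \<in> borel_measurable borel"
  using continuous_on_of_lipschitz[OF assms] by (rule borel_measurable_continuous_onI)

context real_distribution
begin

lemma prob_UNIV: "measure M UNIV = 1"
  using prob_space by simp

lemma integrable_indicator_borel [simp]: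
  "A \<in> sets borel \<Longrightarrow> integrable M (indicator A :: real \<Rightarrow> real)"
  by (intro integrable_real_indicator) (auto simp: emeasure_eq_measure)

subsection \<open>From the Poincare inequality to exponential tails\<close>

lemma measure_le_half_if_symmetric:
  assumes "symmetric_measure M" "0 < b"
  shows "measure M {b..} \<le> 1 / 2" "1 / 2 \<le> measure M {..0}"
proof -
  have "uminus ` {b..} = {..- b}" "uminus ` {..0::real} = {0..}"
    by (auto simp: image_iff intro!: bexI[of _ "- x" for x])
  then have *: "measure M {..- b} = measure M {b..}" "measure M {0..} = measure M {..0}"
    using assms(1) unfolding symmetric_measure_def by (metis atLeast_borel, metis atMost_borel)
  have "measure M ({b..} \<union> {..- b}) = measure M {b..} + measure M {..- b}"
    using assms(2) by (intro finite_measure_Union) auto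
  then show "measure M {b..} \<le> 1 / 2"
    using prob_le_1[of "{b..} \<union> {..- b}"] * by simp
  have "{..0} \<union> {0..} = (UNIV :: real set)" by auto
  then have "1 = measure M ({..0} \<union> {0..})"
    using prob_UNIV by simp
  also have "\<dots> \<le> measure M {..0} + measure M {0..}"
    by (intro measure_Un_le) auto
  finally show "1 / 2 \<le> measure M {..0}" using * by simp
qed

text \<open>The squared derivative of the test function is at most the indicator of
  \<open>{a..}\<close>, which bounds the energy. The variance is bounded below through
  \<open>{a + h..}\<close>, where the test function is at least \<open>h\<close>, and
  \<open>{..0}\<close>, where it vanishes.\<close>

lemma in_class_M_of_convex_poincare:
  assumes sym: "symmetric_measure M" and "0 < Cp" and P: "convex_poincare M Cp"
  shows "in_class_M M (sqrt (8 * Cp)) (1 / 2)"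
proof -
  define h where "h = sqrt (8 * Cp)"
  have h: "h > 0" "h\<^sup>2 = 8 * Cp" using \<open>0 < Cp\<close> by (auto simp: h_def)
  have "measure M {a + h..} \<le> 1 / 2 * measure M {a..}" if a: "a \<ge> 0" for a
  proof -
    define f where "f x = max 0 (x - a)" for x
    define m where "m = (\<integral>x. f x \<partial>M)"
    have f: "convex_on UNIV f"
    proof (rule convex_onI)
      fix t x y :: real assume t: "0 < t" "t < 1"
      have "(1 - t) * x + t * y - a = (1 - t) * (x - a) + t * (y - a)"
        by (simp add: algebra_simps)
      moreover have "(1 - t) * (x - a) \<le> (1 - t) * f x" "t * (y - a) \<le> t * f y"
        "0 \<le> (1 - t) * f x" "0 \<le> t * f y"
        using t by (auto simp: f_def intro!: mult_left_mono)
      ultimately show "f ((1 - t) *\<^sub>R x + t *\<^sub>R y) \<le> (1 - t) * f x + t * f y"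
        by (simp add: f_def[of "(1 - t) * x + t * y"])
    qed auto
    note sub = ls_deriv_subgradient[OF f]
    have d0: "0 \<le> ls_deriv f x" and d1: "ls_deriv f x \<le> 1" for x
      using sub[of x "x - 1"] sub[of x "x + 1"] by (auto simp: f_def max_def split: if_splits)
    have da: "ls_deriv f x = 0" if "x < a" for x
    proof -
      have "ls_deriv f x * (a - x) \<le> 0" using sub[of x a] that by (simp add: f_def)
      then show ?thesis using that d0[of x] by (simp add: mult_le_0_iff)
    qed
    have meas: "ls_deriv f \<in> borel_measurable M"
      using borel_measurable_mono[OF mono_ls_deriv[OF f]] by simp
    have fm: "f \<in> borel_measurable M" by (simp add: f_def[abs_def])
    have "\<exists>B. \<forall>x. \<bar>ls_deriv f x\<bar> \<le> B" using d0 d1 by (intro exI[of _ 1]) auto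
    then have int: "integrable M (\<lambda>x. (f x)\<^sup>2)"
      and var: "(\<integral>x. (f x - m)\<^sup>2 \<partial>M) \<le> Cp * (\<integral>x. (ls_deriv f x)\<^sup>2 \<partial>M)"
      using P f unfolding convex_poincare_def m_def by blast+
    have int1: "integrable M f" using square_integrable_imp_integrable[OF fm int] .
    have int2: "integrable M (\<lambda>x. (f x - m)\<^sup>2)"
      unfolding power2_diff using int int1 by (intro Bochner_Integration.integrable_diff
          Bochner_Integration.integrable_add) auto
    have "(\<integral>x. (ls_deriv f x)\<^sup>2 \<partial>M) \<le> (\<integral>x. indicator {a..} x \<partial>M)"
    proof (rule integral_mono')
      show "integrable M (\<lambda>x. indicator {a..} x :: real)" by simp
      show "(ls_deriv f x)\<^sup>2 \<le> indicator {a..} x" for x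
        using d0[of x] d1[of x] da[of x] by (auto simp: indicator_def power_le_one)
    qed auto
    also have "\<dots> = measure M {a..}" by simp
    finally have upper: "(\<integral>x. (f x - m)\<^sup>2 \<partial>M) \<le> Cp * measure M {a..}"
      using var \<open>0 < Cp\<close> by (meson mult_left_mono less_imp_le order_trans)
    have "(h\<^sup>2 / 2) * measure M {a + h..} = (\<integral>x. (h\<^sup>2 / 2) * indicator {a + h..} x \<partial>M)" by simp
    also have "\<dots> \<le> (\<integral>x. (f x - m)\<^sup>2 * indicator {a + h..} x + m\<^sup>2 * indicator {a + h..} x \<partial>M)"
    proof (rule integral_mono)
      show "integrable M (\<lambda>x. (f x - m)\<^sup>2 * indicator {a + h..} x + m\<^sup>2 * indicator {a + h..} x)"
        using int2 by (intro Bochner_Integration.integrable_add integrable_real_mult_indicator)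
          auto
      show "(h\<^sup>2 / 2) * indicator {a + h..} x
          \<le> (f x - m)\<^sup>2 * indicator {a + h..} x + m\<^sup>2 * indicator {a + h..} x" for x
      proof (cases "x \<in> {a + h..}")
        case True
        then have "h\<^sup>2 \<le> (f x)\<^sup>2" using h by (intro power_mono) (auto simp: f_def)
        \<comment> \<open>Expanded, this says
          \<open>(f x)\<^sup>2 / 2 \<le> (f x - m)\<^sup>2 + m\<^sup>2\<close>, whatever the mean
          \<open>m\<close>.\<close>
        moreover have "0 \<le> (f x - 2 * m)\<^sup>2" by simp
        ultimately show ?thesis using True by (simp add: power2_eq_square algebra_simps)
      qed simp
    qed simp
    also have "\<dots> = (\<integral>x. (f x - m)\<^sup>2 * indicator {a + h..} x \<partial>M) + m\<^sup>2 * measure M {a + h..}"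
      using int2 by (subst Bochner_Integration.integral_add)
        (auto intro!: integrable_real_mult_indicator)
    \<comment> \<open>By symmetry the far tail is no heavier than \<open>{..0}\<close>, where
      \<open>m\<^sup>2\<close> is exactly the value of \<open>(f x - m)\<^sup>2\<close>; both
      contributions then sit on disjoint sets inside the variance.\<close>
    also have "m\<^sup>2 * measure M {a + h..} \<le> m\<^sup>2 * measure M {..0}"
      using measure_le_half_if_symmetric[OF sym, of "a + h"] a h by (intro mult_left_mono) auto
    also have "(\<integral>x. (f x - m)\<^sup>2 * indicator {a + h..} x \<partial>M) + m\<^sup>2 * measure M {..0}
        = (\<integral>x. (f x - m)\<^sup>2 * indicator {a + h..} x + m\<^sup>2 * indicator {..0} x \<partial>M)"
      using int2 by (subst Bochner_Integration.integral_add)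
        (auto intro!: integrable_real_mult_indicator)
    also have "\<dots> \<le> (\<integral>x. (f x - m)\<^sup>2 \<partial>M)"
    proof (rule integral_mono'[OF int2])
      show "(f x - m)\<^sup>2 * indicator {a + h..} x + m\<^sup>2 * indicator {..0} x \<le> (f x - m)\<^sup>2" for x
        using a h by (auto simp: indicator_def f_def)
    qed auto
    finally have "(h\<^sup>2 / 2) * measure M {a + h..} \<le> Cp * measure M {a..}" using upper by simp
    \<comment> \<open>Here \<open>h\<^sup>2 / 2 = 4 * Cp\<close>, so the tail even drops by a factor
      4.\<close>
    then have "4 * measure M {a + h..} \<le> measure M {a..}" using h(2) \<open>0 < Cp\<close> by simp
    then show ?thesis using measure_nonneg[of M "{a + h..}"] by linarith
  qed
  then show ?thesis using h sym unfolding in_class_M_def h_def by simp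
qed

subsection \<open>From property tau to the Poincare inequality\<close>

text \<open>For the test function \<open>\<bar>x\<bar> / C\<close> the infimum convolution loses at
  most 1/2, so the first factor in tau controls the exponential moment.\<close>

lemma integrable_exp_of_convex_tau:
  assumes "C > 0" and tau: "convex_tau M C"
  shows "integrable M (\<lambda>x. exp (\<bar>x\<bar> / C))"
proof -
  define f where "f x = \<bar>x\<bar> / C" for x :: real
  let ?A = "\<integral>\<^sup>+x. ennreal (exp (inf_conv f (\<lambda>z. phi0 (z / C)) x)) \<partial>M"
  let ?B = "\<integral>\<^sup>+x. ennreal (exp (- f x)) \<partial>M"
  have "convex_on UNIV f"
    unfolding f_def[abs_def] using \<open>C > 0\<close> by (rule convex_on_abs_div)
  moreover have "bdd_below (range f)"
    using \<open>C > 0\<close> by (intro bdd_belowI[of _ 0]) (auto simp: f_def)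
  ultimately have AB: "?A * ?B \<le> 1" using tau unfolding convex_tau_def by blast
  have fm: "f \<in> borel_measurable M" by (simp add: f_def[abs_def])
  \<comment> \<open>Only a nonzero second factor lets the product bound exclude an infinite first
    one, because \<open>\<infinity> * 0 = 0\<close>.\<close>
  have "?B \<noteq> 0"
    using fm by (subst nn_integral_0_iff_AE) (auto simp: AE_False)
  then have "?A \<noteq> \<infinity>" using AB by (auto simp: ennreal_top_mult top_unique split: if_splits)
  have "(\<integral>\<^sup>+x. ennreal (exp (-1/2) * exp (\<bar>x\<bar> / C)) \<partial>M) \<le> ?A"
  proof (intro nn_integral_mono ennreal_leI)
    fix x
    have "\<bar>x\<bar> / C - 1 / 2 \<le> inf_conv f (\<lambda>z. phi0 (z / C)) x"
    proof (rule le_inf_conv)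
      fix y
      have "\<bar>x / C\<bar> - 1 / 2 \<le> phi0 (x / C)" by (rule abs_le_phi0)
      also have "phi0 (x / C) \<le> phi0 ((x - y) / C) + \<bar>y / C\<bar>"
        using phi0_add_le[of "(x - y) / C" "y / C"] by (simp add: diff_divide_distrib)
      finally show "\<bar>x\<bar> / C - 1 / 2 \<le> f y + phi0 ((x - y) / C)"
        using \<open>C > 0\<close> by (simp add: f_def)
    qed
    then show "exp (-1/2) * exp (\<bar>x\<bar> / C) \<le> exp (inf_conv f (\<lambda>z. phi0 (z / C)) x)"
      by (simp flip: exp_add)
  qed
  then have "(\<integral>\<^sup>+x. ennreal (exp (-1/2) * exp (\<bar>x\<bar> / C)) \<partial>M) < \<infinity>"
    by (rule order_le_less_trans) (use \<open>?A \<noteq> \<infinity>\<close> in \<open>simp add: less_top\<close>)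
  then have "integrable M (\<lambda>x. exp (-1/2) * exp (\<bar>x\<bar> / C))"
    by (intro integrableI_nonneg) auto
  then show ?thesis by simp
qed


text \<open>\<open>ennreal\<close> cuts negative values to 0, so for integrands of variable sign
  only an inequality remains. The Taylor minorants used below are of this kind.\<close>

lemma ennreal_integral_le_nn_integral:
  fixes l :: "real \<Rightarrow> real"
  assumes "integrable M l"
  shows "ennreal (\<integral>x. l x \<partial>M) \<le> (\<integral>\<^sup>+x. ennreal (l x) \<partial>M)"
proof -
  have "(\<integral>x. l x \<partial>M) \<le> (\<integral>x. max 0 (l x) \<partial>M)"
    using assms by (intro integral_mono) auto
  then have "ennreal (\<integral>x. l x \<partial>M) \<le> ennreal (\<integral>x. max 0 (l x) \<partial>M)" by (rule ennreal_leI)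
  also have "\<dots> = (\<integral>\<^sup>+x. ennreal (max 0 (l x)) \<partial>M)"
    using assms by (intro nn_integral_eq_integral[symmetric]) auto
  also have "\<dots> = (\<integral>\<^sup>+x. ennreal (l x) \<partial>M)"
    by (intro nn_integral_cong) (simp add: max_def ennreal_neg)
  finally show ?thesis .
qed

text \<open>The cube is the size of the third-order error in the expansion below. Growth of
  \<open>g\<close> is linear, and \<open>1 + y \<le> 3 * exp (y / 3)\<close> turns into a bound by
  \<open>exp y\<close> after cubing.\<close>

lemma integrable_cube_of_lipschitz:
  fixes g :: "real \<Rightarrow> real"
  assumes "0 < C" and e: "integrable M (\<lambda>x. exp (\<bar>x\<bar> / C))"
    and g: "\<And>x y. \<bar>g y - g x\<bar> \<le> B * \<bar>y - x\<bar>"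
  shows "integrable M (\<lambda>x. (1 + \<bar>g x\<bar>) ^ 3)"
proof -
  have B: "0 \<le> B" using order_trans[OF abs_ge_zero g[of 1 0]] by simp
  have [measurable]: "g \<in> borel_measurable borel" by (rule borel_measurable_of_lipschitz[OF g])
  define a where "a = 1 + \<bar>g 0\<bar> + B * C"
  have bound: "(1 + \<bar>g x\<bar>) ^ 3 \<le> 27 * a ^ 3 * exp (\<bar>x\<bar> / C)" for x
  proof -
    define y where "y = \<bar>x\<bar> / C"
    have y: "0 \<le> y" using \<open>0 < C\<close> by (simp add: y_def)
    have "\<bar>g x\<bar> \<le> \<bar>g 0\<bar> + B * \<bar>x\<bar>" using g[of x 0] by simp
    also have "B * \<bar>x\<bar> = B * C * y" using \<open>0 < C\<close> by (simp add: y_def)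
    finally have "1 + \<bar>g x\<bar> \<le> 1 + \<bar>g 0\<bar> + B * C * y" by simp
    also have "\<dots> \<le> a * (1 + y)"
      using y B \<open>0 < C\<close> by (simp add: a_def algebra_simps)
    also have "\<dots> \<le> a * (3 * exp (y / 3))"
    proof (rule mult_left_mono)
      show "1 + y \<le> 3 * exp (y / 3)" using exp_ge_add_one_self[of "y / 3"] by linarith
    qed (use B \<open>0 < C\<close> in \<open>simp add: a_def\<close>)
    finally have "(1 + \<bar>g x\<bar>) ^ 3 \<le> (a * (3 * exp (y / 3))) ^ 3"
      by (intro power_mono) auto
    also have "\<dots> = 27 * a ^ 3 * exp (y / 3) ^ 3" by (simp add: power_mult_distrib)
    also have "exp (y / 3) ^ 3 = exp y" by (simp flip: exp_of_nat_mult)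
    finally show ?thesis by (simp add: y_def)
  qed
  show ?thesis
  proof (rule Bochner_Integration.integrable_bound)
    show "integrable M (\<lambda>x. 27 * a ^ 3 * exp (\<bar>x\<bar> / C))" using e by simp
    show "AE x in M. norm ((1 + \<bar>g x\<bar>) ^ 3) \<le> norm (27 * a ^ 3 * exp (\<bar>x\<bar> / C))"
      using bound by (auto intro!: AE_I2 order_trans[OF _ abs_ge_self])
  qed simp
qed

end

section \<open>Lower Taylor bounds for the exponential\<close>

lemma exp_ge_cubic: "1 + u + u\<^sup>2 / 2 + u ^ 3 / 6 \<le> exp (u :: real)"
proof -
  obtain t where "exp u = (\<Sum>m<4. u ^ m / fact m) + exp t / fact 4 * u ^ 4"
    using Maclaurin_exp_le[of u 4] by blast
  moreover have "(\<Sum>m<4. u ^ m / fact m) = 1 + u + u\<^sup>2 / 2 + u ^ 3 / 6"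
    by (simp add: eval_nat_numeral fact_numeral)
  moreover have "0 \<le> exp t / fact 4 * u ^ 4" by simp
  ultimately show ?thesis by linarith
qed

text \<open>A second-order expansion with an error of order \<open>\<epsilon> ^ 3\<close>, uniform
  for \<open>\<epsilon> \<le> 1\<close>. In its constant, \<open>m\<close> pays for the cross term
  of the square and \<open>(1 + m) ^ 3\<close> for the cubic term.\<close>

lemma exp_ge_quadratic_cube:
  fixes g q \<epsilon> :: real
  assumes \<epsilon>: "0 < \<epsilon>" "\<epsilon> \<le> 1" and q: "0 \<le> q" "q \<le> m"
  shows "1 + \<epsilon> * g + \<epsilon>\<^sup>2 * (g\<^sup>2 / 2 - q) - \<epsilon> ^ 3 * ((m + (1 + m) ^ 3) * (1 + \<bar>g\<bar>) ^ 3)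
    \<le> exp (\<epsilon> * g - \<epsilon>\<^sup>2 * q)"
proof -
  define u where "u = \<epsilon> * g - \<epsilon>\<^sup>2 * q"
  define w where "w = 1 + \<bar>g\<bar>"
  have w: "1 \<le> w" by (simp add: w_def)
  have u: "u = \<epsilon> * (g - \<epsilon> * q)" by (simp add: u_def power2_eq_square algebra_simps)
  have "g * q \<le> \<bar>g\<bar> * q" using q by (intro mult_right_mono) auto
  also have "\<dots> \<le> w * m" using q w by (intro mult_mono) (auto simp: w_def)
  also have "w * m \<le> w ^ 3 * m" using w q self_le_power[of w 3] by (intro mult_right_mono) auto
  finally have gq: "g * q \<le> w ^ 3 * m" .
  have "\<epsilon> ^ 3 * (g * q) \<le> \<epsilon> ^ 3 * (w ^ 3 * m)" using gq \<epsilon> by (intro mult_left_mono) auto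
  moreover have "u\<^sup>2 / 2 = \<epsilon>\<^sup>2 * g\<^sup>2 / 2 - \<epsilon> ^ 3 * (g * q) + (\<epsilon>\<^sup>2 * q)\<^sup>2 / 2"
    by (simp add: u_def power2_eq_square power3_eq_cube field_simps)
  moreover have "0 \<le> (\<epsilon>\<^sup>2 * q)\<^sup>2" by simp
  ultimately have u2: "\<epsilon>\<^sup>2 * g\<^sup>2 / 2 - \<epsilon> ^ 3 * (w ^ 3 * m) \<le> u\<^sup>2 / 2" by linarith
  have "\<bar>g - \<epsilon> * q\<bar> \<le> \<bar>g\<bar> + \<epsilon> * q" using abs_triangle_ineq4[of g "\<epsilon> * q"] \<epsilon> q by simp
  also have "\<epsilon> * q \<le> 1 * m" using \<epsilon> q by (intro mult_mono) auto
  also have "\<bar>g\<bar> + 1 * m \<le> (1 + m) * w" using q by (simp add: w_def algebra_simps)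
  finally have "\<bar>u\<bar> \<le> \<epsilon> * ((1 + m) * w)" using \<epsilon> by (simp add: u abs_mult)
  then have "\<bar>u\<bar> ^ 3 \<le> (\<epsilon> * ((1 + m) * w)) ^ 3" by (intro power_mono) auto
  then have "\<bar>u ^ 3\<bar> \<le> \<epsilon> ^ 3 * ((1 + m) ^ 3 * w ^ 3)" by (simp add: power_abs power_mult_distrib)
  then have u3: "- (\<epsilon> ^ 3 * ((1 + m) ^ 3 * w ^ 3)) \<le> u ^ 3 / 6" by (simp add: abs_le_iff)
  have "1 + \<epsilon> * g + \<epsilon>\<^sup>2 * (g\<^sup>2 / 2 - q) - \<epsilon> ^ 3 * ((m + (1 + m) ^ 3) * w ^ 3)
     = 1 + u + (\<epsilon>\<^sup>2 * g\<^sup>2 / 2 - \<epsilon> ^ 3 * (w ^ 3 * m)) - \<epsilon> ^ 3 * ((1 + m) ^ 3 * w ^ 3)"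
    by (simp add: u_def algebra_simps)
  also have "\<dots> \<le> exp u" using u2 u3 exp_ge_cubic[of u] by linarith
  finally show ?thesis by (simp add: u_def w_def)
qed

context real_distribution
begin

text \<open>The subgradient selection \<open>p\<close> is left free so that truncated functions can
  be treated. Both factors of tau are expanded at a small multiple of the centred function, and the
  coefficients of \<open>\<epsilon>\<^sup>2\<close> are compared.\<close>

lemma variance_le_of_convex_tau:
  assumes "C > 0" and tau: "convex_tau M C"
    and f: "convex_on UNIV f" "\<And>y. b \<le> f y" and lip: "\<And>x y. \<bar>f y - f x\<bar> \<le> B * \<bar>y - x\<bar>"
    and [measurable]: "p \<in> borel_measurable borel" and p: "\<And>x. \<bar>p x\<bar> \<le> B"
    and sub: "\<And>x y. f x + p x * (y - x) \<le> f y"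
  shows "(\<integral>x. (f x - (\<integral>y. f y \<partial>M))\<^sup>2 \<partial>M) \<le> C\<^sup>2 / 2 * (\<integral>x. (p x)\<^sup>2 \<partial>M)"
proof -
  have B: "0 \<le> B" using p[of 0] by linarith
  define g where "g x = f x - (\<integral>y. f y \<partial>M)" for x
  define q where "q x = C\<^sup>2 / 2 * (p x)\<^sup>2" for x
  define m where "m = C\<^sup>2 / 2 * B\<^sup>2"
  define w where "w x = (1 + \<bar>g x\<bar>) ^ 3" for x
  define K where "K = m + (1 + m) ^ 3"
  have [measurable]: "f \<in> borel_measurable borel" by (rule borel_measurable_of_lipschitz[OF lip])
  have [measurable]: "g \<in> borel_measurable borel" "q \<in> borel_measurable borel"
    by (simp_all add: g_def[abs_def] q_def[abs_def])
  have q: "0 \<le> q x" "q x \<le> m" for x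
  proof -
    have "(p x)\<^sup>2 \<le> B\<^sup>2" using p[of x] B by (simp add: power2_le_iff_abs_le)
    then show "0 \<le> q x" "q x \<le> m" by (auto simp: q_def m_def intro!: mult_left_mono)
  qed
  have m: "0 \<le> m" by (simp add: m_def)
  have w_int: "integrable M w"
    unfolding w_def[abs_def] using \<open>C > 0\<close> lip
    by (intro integrable_cube_of_lipschitz[where C = C and B = B] integrable_exp_of_convex_tau tau)
      (auto simp: g_def)
  have q_int: "integrable M q"
    using q by (intro integrable_const_bound[of _ m]) auto
  have g_w: "\<bar>g x\<bar> \<le> w x" "(g x)\<^sup>2 \<le> w x" for x
  proof -
    have "\<bar>g x\<bar> ^ k \<le> w x" if "k \<le> 3" for k
    proof -
      have "\<bar>g x\<bar> ^ k \<le> (1 + \<bar>g x\<bar>) ^ k" by (intro power_mono) auto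
      also have "\<dots> \<le> w x" unfolding w_def using that by (intro power_increasing) auto
      finally show ?thesis .
    qed
    from this[of 1] this[of 2] show "\<bar>g x\<bar> \<le> w x" "(g x)\<^sup>2 \<le> w x" by simp_all
  qed
  have w_pos: "0 \<le> w x" for x using g_w(1)[of x] by linarith
  have g_int: "integrable M g"
    using w_int by (rule Bochner_Integration.integrable_bound) (use g_w w_pos in auto)
  have g2_int: "integrable M (\<lambda>x. (g x)\<^sup>2)"
    using w_int by (rule Bochner_Integration.integrable_bound) (use g_w w_pos in auto)
  have "integrable M (\<lambda>x. g x + (\<integral>y. f y \<partial>M))" using g_int by simp
  then have f_int: "integrable M f" by (simp add: g_def)
  have g_mean: "(\<integral>x. g x \<partial>M) = 0"
    using f_int by (simp add: g_def prob_UNIV)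
  define V where "V = (\<integral>x. (g x)\<^sup>2 \<partial>M)"
  define I where "I = (\<integral>x. q x \<partial>M)"
  define W where "W = K * (\<integral>x. w x \<partial>M)"
  \<comment> \<open>\<open>\<alpha>\<close> and \<open>\<beta>\<close> are the integrated lower
    expansions of the two factors; the first-order terms vanish because \<open>g\<close> has mean
    0.\<close>
  define \<alpha> where "\<alpha> \<epsilon> = 1 + \<epsilon>\<^sup>2 * (V / 2 - I) - \<epsilon> ^ 3 * W" for \<epsilon>
  define \<beta> where "\<beta> \<epsilon> = 1 + \<epsilon>\<^sup>2 * (V / 2) - \<epsilon> ^ 3 * W" for \<epsilon>
  have key: "ennreal (\<alpha> \<epsilon>) * ennreal (\<beta> \<epsilon>) \<le> 1" if \<epsilon>: "0 < \<epsilon>" "\<epsilon> \<le> 1" "\<epsilon> * (B * C) \<le> 1" for \<epsilon>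
  proof -
    let ?Q = "inf_conv (\<lambda>x. \<epsilon> * g x) (\<lambda>z. phi0 (z / C))"
    have "convex_on UNIV (\<lambda>x. f x + - (\<integral>y. f y \<partial>M))"
      using f(1) by (intro convex_on_add) (auto simp: convex_on_const)
    then have "convex_on UNIV g" by (simp add: g_def[abs_def])
    then have "convex_on UNIV (\<lambda>x. \<epsilon> * g x)" using \<epsilon> by (intro convex_on_cmul) auto
    moreover have "bdd_below (range (\<lambda>x. \<epsilon> * g x))"
      using f(2) \<epsilon> by (intro bdd_belowI[of _ "\<epsilon> * (b - (\<integral>y. f y \<partial>M))"]) (auto simp: g_def)
    ultimately have le1: "(\<integral>\<^sup>+x. ennreal (exp (?Q x)) \<partial>M) * (\<integral>\<^sup>+x. ennreal (exp (- (\<epsilon> * g x))) \<partial>M) \<le> 1"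
      using tau unfolding convex_tau_def by blast
    have Q: "\<epsilon> * g x - \<epsilon>\<^sup>2 * q x \<le> ?Q x" for x
    proof (rule le_inf_conv)
      fix y
      \<comment> \<open>The slope of \<open>\<epsilon> * g\<close> in the variable rescaled by
        \<open>C\<close>. The condition \<open>\<epsilon> * (B * C) \<le> 1\<close> puts it in
        \<open>[-1, 1]\<close>, where the affine bound for \<open>phi0\<close> applies with loss
        \<open>P\<^sup>2 / 2\<close>.\<close>
      define P where "P = \<epsilon> * p x * C"
      have "\<bar>P\<bar> \<le> \<epsilon> * (B * C)"
        using p[of x] \<epsilon> \<open>C > 0\<close> by (simp add: P_def abs_mult)
      then have "P * ((x - y) / C) - P\<^sup>2 / 2 \<le> phi0 ((x - y) / C)"
        using \<epsilon> by (intro phi0_ge_affine) simp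
      moreover have "P * ((x - y) / C) = \<epsilon> * p x * (x - y)" "P\<^sup>2 / 2 = \<epsilon>\<^sup>2 * q x"
        using \<open>C > 0\<close> by (simp_all add: P_def q_def power_mult_distrib)
      moreover have "\<epsilon> * (g x + p x * (y - x)) \<le> \<epsilon> * g y"
        using sub[of x y] \<epsilon> by (intro mult_left_mono) (auto simp: g_def)
      ultimately show "\<epsilon> * g x - \<epsilon>\<^sup>2 * q x \<le> \<epsilon> * g y + phi0 ((x - y) / C)"
        by (simp add: algebra_simps)
    qed
    have alpha_eq: "\<alpha> \<epsilon> = (\<integral>x. 1 + \<epsilon> * g x + \<epsilon>\<^sup>2 * ((g x)\<^sup>2 / 2 - q x) - \<epsilon> ^ 3 * (K * w x) \<partial>M)"
      using g_int g2_int q_int w_int by (simp add: \<alpha>_def V_def I_def W_def g_mean prob_UNIV)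
    have "ennreal (\<alpha> \<epsilon>) \<le> (\<integral>\<^sup>+x. ennreal (1 + \<epsilon> * g x + \<epsilon>\<^sup>2 * ((g x)\<^sup>2 / 2 - q x) - \<epsilon> ^ 3 * (K * w x)) \<partial>M)"
      using g_int g2_int q_int w_int unfolding alpha_eq by (intro ennreal_integral_le_nn_integral) simp
    also have "\<dots> \<le> (\<integral>\<^sup>+x. ennreal (exp (?Q x)) \<partial>M)"
    proof (intro nn_integral_mono ennreal_leI)
      fix x
      show "1 + \<epsilon> * g x + \<epsilon>\<^sup>2 * ((g x)\<^sup>2 / 2 - q x) - \<epsilon> ^ 3 * (K * w x) \<le> exp (?Q x)"
        using exp_ge_quadratic_cube[OF \<epsilon>(1,2) q(1,2), of "g x" x] Q[of x]
        unfolding K_def w_def by (meson exp_le_cancel_iff order_trans)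
    qed
    finally have A: "ennreal (\<alpha> \<epsilon>) \<le> (\<integral>\<^sup>+x. ennreal (exp (?Q x)) \<partial>M)" .
    have beta_eq: "\<beta> \<epsilon> = (\<integral>x. 1 + \<epsilon> * (- g x) + \<epsilon>\<^sup>2 * ((g x)\<^sup>2 / 2) - \<epsilon> ^ 3 * (K * w x) \<partial>M)"
      using g_int g2_int w_int by (simp add: \<beta>_def V_def W_def g_mean prob_UNIV)
    have "ennreal (\<beta> \<epsilon>) \<le> (\<integral>\<^sup>+x. ennreal (1 + \<epsilon> * (- g x) + \<epsilon>\<^sup>2 * ((g x)\<^sup>2 / 2) - \<epsilon> ^ 3 * (K * w x)) \<partial>M)"
      using g_int g2_int w_int unfolding beta_eq by (intro ennreal_integral_le_nn_integral) simp
    also have "\<dots> \<le> (\<integral>\<^sup>+x. ennreal (exp (- (\<epsilon> * g x))) \<partial>M)"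
    proof (intro nn_integral_mono ennreal_leI)
      fix x
      show "1 + \<epsilon> * (- g x) + \<epsilon>\<^sup>2 * ((g x)\<^sup>2 / 2) - \<epsilon> ^ 3 * (K * w x) \<le> exp (- (\<epsilon> * g x))"
        using exp_ge_quadratic_cube[OF \<epsilon>(1,2) order_refl m, of "- g x"]
        unfolding K_def w_def by simp
    qed
    finally have "ennreal (\<alpha> \<epsilon>) * ennreal (\<beta> \<epsilon>) \<le>
      (\<integral>\<^sup>+x. ennreal (exp (?Q x)) \<partial>M) * (\<integral>\<^sup>+x. ennreal (exp (- (\<epsilon> * g x))) \<partial>M)"
      using A by (intro mult_mono) auto
    then show ?thesis using le1 by (rule order_trans)
  qed
  \<comment> \<open>Removing the factor \<open>\<epsilon>\<^sup>2\<close> leaves a bracket that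
    tends to \<open>V - I\<close>, so
    \<open>\<alpha> \<epsilon> * \<beta> \<epsilon> \<le> 1\<close> survives in the limit as
    \<open>V \<le> I\<close>.\<close>
  have expand: "(1 + \<epsilon>\<^sup>2 * a - \<epsilon> ^ 3 * W) * (1 + \<epsilon>\<^sup>2 * b - \<epsilon> ^ 3 * W) - 1
      = \<epsilon>\<^sup>2 * (a + b - 2 * (\<epsilon> * W) + \<epsilon>\<^sup>2 * (a - \<epsilon> * W) * (b - \<epsilon> * W))" for \<epsilon> a b :: real
    by algebra
  have lim: "((\<lambda>\<epsilon>. (V / 2 - I) + V / 2 - 2 * (\<epsilon> * W) + \<epsilon>\<^sup>2 * ((V / 2 - I) - \<epsilon> * W) * (V / 2 - \<epsilon> * W))
      \<longlongrightarrow> (V / 2 - I) + V / 2 - 2 * (0 * W) + 0\<^sup>2 * ((V / 2 - I) - 0 * W) * (V / 2 - 0 * W)) (at_right 0)"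
    by (intro tendsto_intros)
  have "(\<alpha> \<longlongrightarrow> 1 + 0\<^sup>2 * (V / 2 - I) - 0 ^ 3 * W) (at_right 0)"
    "(\<beta> \<longlongrightarrow> 1 + 0\<^sup>2 * (V / 2) - 0 ^ 3 * W) (at_right 0)"
    unfolding \<alpha>_def \<beta>_def by (intro tendsto_intros)+
  \<comment> \<open>Positivity near 0 allows the product of \<open>ennreal\<close> values to be read
    as a product of reals.\<close>
  then have pos: "eventually (\<lambda>\<epsilon>. \<alpha> \<epsilon> > 0) (at_right 0)" "eventually (\<lambda>\<epsilon>. \<beta> \<epsilon> > 0) (at_right 0)"
    by (auto dest!: order_tendstoD(1)[where a = 0])
  have "((\<lambda>\<epsilon>. \<epsilon> * (B * C)) \<longlongrightarrow> 0 * (B * C)) (at_right 0)" by (intro tendsto_intros)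
  then have small: "eventually (\<lambda>\<epsilon>. \<epsilon> * (B * C) < 1) (at_right 0)"
    by (auto dest!: order_tendstoD(2)[where a = 1])
  have "eventually (\<lambda>\<epsilon>::real. 0 < \<epsilon> \<and> \<epsilon> < 1) (at_right 0)"
    by (auto simp: eventually_at_right_field intro!: exI[of _ 1])
  then have "eventually (\<lambda>\<epsilon>. (V / 2 - I) + V / 2 - 2 * (\<epsilon> * W)
      + \<epsilon>\<^sup>2 * ((V / 2 - I) - \<epsilon> * W) * (V / 2 - \<epsilon> * W) \<le> 0) (at_right 0)"
    using pos small
  proof eventually_elim
    case (elim \<epsilon>)
    have "ennreal (\<alpha> \<epsilon> * \<beta> \<epsilon>) \<le> 1" using key[of \<epsilon>] elim by (simp add: ennreal_mult)
    then have "\<alpha> \<epsilon> * \<beta> \<epsilon> \<le> 1" by simp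
    moreover have "\<alpha> \<epsilon> * \<beta> \<epsilon> - 1 = \<epsilon>\<^sup>2 * ((V / 2 - I) + V / 2 - 2 * (\<epsilon> * W)
      + \<epsilon>\<^sup>2 * ((V / 2 - I) - \<epsilon> * W) * (V / 2 - \<epsilon> * W))"
      unfolding \<alpha>_def \<beta>_def by (rule expand)
    ultimately have "\<epsilon>\<^sup>2 * ((V / 2 - I) + V / 2 - 2 * (\<epsilon> * W)
      + \<epsilon>\<^sup>2 * ((V / 2 - I) - \<epsilon> * W) * (V / 2 - \<epsilon> * W)) \<le> 0" by linarith
    then show ?case using elim by (simp add: mult_le_0_iff)
  qed
  from tendsto_upperbound[OF lim this] have "V \<le> I" by simp
  then show ?thesis by (simp add: V_def I_def g_def q_def)
qed

text \<open>Property tau speaks only of functions bounded below, so \<open>f\<close> is truncated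
  from below and the variances pass to the limit.\<close>

lemma convex_poincare_of_convex_tau:
  assumes "C > 0" and tau: "convex_tau M C"
  shows "convex_poincare M (C\<^sup>2 / 2)"
  unfolding convex_poincare_def
proof (intro allI impI, elim conjE exE)
  fix f :: "real \<Rightarrow> real" and B
  assume f: "convex_on UNIV f" and B: "\<forall>x. \<bar>ls_deriv f x\<bar> \<le> B"
  note lip = lipschitz_of_bounded_ls_deriv[OF f B[rule_format]]
  have [measurable]: "f \<in> borel_measurable borel" by (rule borel_measurable_of_lipschitz[OF lip])
  have [measurable]: "ls_deriv f \<in> borel_measurable borel"
    by (rule borel_measurable_mono[OF mono_ls_deriv[OF f]])
  have cube: "integrable M (\<lambda>x. (1 + \<bar>f x\<bar>) ^ 3)"
    using \<open>C > 0\<close> lip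
    by (intro integrable_cube_of_lipschitz[where C = C and B = B] integrable_exp_of_convex_tau tau)
  have f2: "integrable M (\<lambda>x. (f x)\<^sup>2)"
  proof (rule Bochner_Integration.integrable_bound[OF cube])
    have "(f x)\<^sup>2 \<le> (1 + \<bar>f x\<bar>) ^ 3" for x
    proof -
      have "\<bar>f x\<bar>\<^sup>2 \<le> (1 + \<bar>f x\<bar>)\<^sup>2" by (intro power_mono) auto
      also have "\<dots> \<le> (1 + \<bar>f x\<bar>) ^ 3" by (intro power_increasing) auto
      finally show ?thesis by simp
    qed
    then show "AE x in M. norm ((f x)\<^sup>2) \<le> norm ((1 + \<bar>f x\<bar>) ^ 3)"
      by (auto intro!: AE_I2 order_trans[OF _ abs_ge_self])
  qed simp
  have f1: "integrable M f" by (rule square_integrable_imp_integrable[OF _ f2]) simp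
  define F where "F n x = max (f x) (- real n)" for n x
  have [measurable]: "F n \<in> borel_measurable borel" for n by (simp add: F_def[abs_def])
  have F_le: "\<bar>F n x\<bar> \<le> \<bar>f x\<bar>" for n x by (simp add: F_def)
  have F_lim: "(\<lambda>n. F n x) \<longlonglongrightarrow> f x" for x
  proof (rule tendsto_eventually)
    obtain N where "- f x \<le> real N" using real_arch_simple by blast
    then show "eventually (\<lambda>n. F n x = f x) sequentially"
      by (auto simp: F_def eventually_sequentially intro!: exI[of _ N])
  qed
  have F1: "integrable M (F n)" for n
    using f1 by (rule Bochner_Integration.integrable_bound) (use F_le in auto)
  have F2: "integrable M (\<lambda>x. (F n x)\<^sup>2)" for n
    using f2 by (rule Bochner_Integration.integrable_bound) (use F_le in \<open>auto simp: abs_le_square_iff[symmetric]\<close>)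
  have lim1: "(\<lambda>n. \<integral>x. F n x \<partial>M) \<longlonglongrightarrow> (\<integral>x. f x \<partial>M)"
    by (rule integral_dominated_convergence[where w = "\<lambda>x. \<bar>f x\<bar>"])
      (use f1 F_lim F_le in auto)
  have lim2: "(\<lambda>n. \<integral>x. (F n x)\<^sup>2 \<partial>M) \<longlonglongrightarrow> (\<integral>x. (f x)\<^sup>2 \<partial>M)"
    by (rule integral_dominated_convergence[where w = "\<lambda>x. (f x)\<^sup>2"])
      (use f2 F_lim F_le in \<open>auto simp: abs_le_square_iff[symmetric] intro!: tendsto_power\<close>)
  have bound: "(\<integral>x. (F n x)\<^sup>2 \<partial>M) - (\<integral>x. F n x \<partial>M)\<^sup>2 \<le> C\<^sup>2 / 2 * (\<integral>x. (ls_deriv f x)\<^sup>2 \<partial>M)" for n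
  proof -
    \<comment> \<open>A subgradient of the truncation: slope 0 wherever \<open>F n\<close> takes its
      floor value, so the energy never exceeds that of \<open>f\<close>.\<close>
    define p where "p x = (if f x > - real n then ls_deriv f x else 0)" for x
    have pm [measurable]: "p \<in> borel_measurable borel" unfolding p_def[abs_def] by measurable
    have "(\<integral>x. (F n x - (\<integral>y. F n y \<partial>M))\<^sup>2 \<partial>M) \<le> C\<^sup>2 / 2 * (\<integral>x. (p x)\<^sup>2 \<partial>M)"
    proof (rule variance_le_of_convex_tau[OF \<open>C > 0\<close> tau _ _ _ pm, where B = B and b = "- real n"])
      show "convex_on UNIV (F n)"
        unfolding F_def[abs_def]
      proof (rule convex_onI)
        fix t x y :: real assume t: "0 < t" "t < 1"
        have "f ((1 - t) *\<^sub>R x + t *\<^sub>R y) \<le> (1 - t) * f x + t * f y"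
          using t by (intro convex_onD[OF f]) auto
        moreover have "(1 - t) * f x \<le> (1 - t) * max (f x) (- real n)"
          "t * f y \<le> t * max (f y) (- real n)"
          "(1 - t) * (- real n) \<le> (1 - t) * max (f x) (- real n)"
          "t * (- real n) \<le> t * max (f y) (- real n)"
          using t mult_left_mono[of "- real n" "max (f x) (- real n)" "1 - t"]
            mult_left_mono[of "- real n" "max (f y) (- real n)" t]
          by (auto intro!: mult_left_mono)
        ultimately show "max (f ((1 - t) *\<^sub>R x + t *\<^sub>R y)) (- real n)
            \<le> (1 - t) * max (f x) (- real n) + t * max (f y) (- real n)"
          by (intro max.boundedI) (simp_all add: algebra_simps)
      qed auto
      show "- real n \<le> F n y" for y by (simp add: F_def)
      show "\<bar>F n y - F n x\<bar> \<le> B * \<bar>y - x\<bar>" for x y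
        using lip[of y x] by (auto simp: F_def max_def abs_if split: if_splits)
      show "\<bar>p x\<bar> \<le> B" for x using B[rule_format, of x] by (auto simp: p_def)
      show "F n x + p x * (y - x) \<le> F n y" for x y
        using ls_deriv_subgradient[OF f, of x y] by (auto simp: F_def p_def max_def)
    qed
    also have "(\<integral>x. (p x)\<^sup>2 \<partial>M) \<le> (\<integral>x. (ls_deriv f x)\<^sup>2 \<partial>M)"
    proof (rule integral_mono')
      have "(ls_deriv f x)\<^sup>2 \<le> B\<^sup>2" for x
        using B[rule_format, of x] by (simp add: power2_le_iff_abs_le)
      then show "integrable M (\<lambda>x. (ls_deriv f x)\<^sup>2)"
        by (intro integrable_const_bound[of _ "B\<^sup>2"]) auto
    qed (auto simp: p_def)
    finally show ?thesis using variance_eq[OF F1 F2] by (simp add: mult_left_mono)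
  qed
  \<comment> \<open>Written as second moment minus squared mean, the variance converges term by term
    by domination.\<close>
  have "(\<integral>x. (f x)\<^sup>2 \<partial>M) - (\<integral>x. f x \<partial>M)\<^sup>2 \<le> C\<^sup>2 / 2 * (\<integral>x. (ls_deriv f x)\<^sup>2 \<partial>M)"
  proof (rule LIMSEQ_le_const2)
    show "(\<lambda>n. (\<integral>x. (F n x)\<^sup>2 \<partial>M) - (\<integral>x. F n x \<partial>M)\<^sup>2) \<longlonglongrightarrow> (\<integral>x. (f x)\<^sup>2 \<partial>M) - (\<integral>x. f x \<partial>M)\<^sup>2"
      by (intro tendsto_intros lim1 lim2)
  qed (use bound in auto)
  then show "integrable M (\<lambda>x. (f x)\<^sup>2) \<and>
      (\<integral>x. (f x - (\<integral>y. f y \<partial>M))\<^sup>2 \<partial>M) \<le> C\<^sup>2 / 2 * (\<integral>x. (ls_deriv f x)\<^sup>2 \<partial>M)"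
    using f2 variance_eq[OF f1 f2] by simp
qed


subsection \<open>From exponential tails to property tau\<close>

text \<open>The level sets \<open>t \<le> H x\<close> are taken with a weak inequality, so that for
  continuous monotone functions they are closed rays as in the tail condition.\<close>

lemma nn_integral_layer_cake:
  fixes H :: "real \<Rightarrow> real"
  assumes [measurable]: "H \<in> borel_measurable borel" and "\<And>x. 0 \<le> H x"
  shows "(\<integral>\<^sup>+x. ennreal (H x) \<partial>M) = (\<integral>\<^sup>+t. indicator {0<..} t * emeasure M {x. t \<le> H x} \<partial>lborel)"
proof -
  interpret pair_sigma_finite M lborel ..
  have "(\<integral>\<^sup>+x. ennreal (H x) \<partial>M) = (\<integral>\<^sup>+x. \<integral>\<^sup>+t. indicator {0<..H x} t \<partial>lborel \<partial>M)"
    using assms(2) by simp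
  also have "\<dots> = (\<integral>\<^sup>+x. \<integral>\<^sup>+t. (if 0 < t \<and> t \<le> H x then 1 else 0) \<partial>lborel \<partial>M)"
    by (intro nn_integral_cong) (auto simp: indicator_def)
  also have "\<dots> = (\<integral>\<^sup>+t. \<integral>\<^sup>+x. (if 0 < t \<and> t \<le> H x then 1 else 0) \<partial>M \<partial>lborel)"
    by (rule Fubini'[symmetric]) measurable
  also have "\<dots> = (\<integral>\<^sup>+t. \<integral>\<^sup>+x. indicator {0<..} t * indicator {x. t \<le> H x} x \<partial>M \<partial>lborel)"
    by (intro nn_integral_cong) (auto simp: indicator_def)
  also have "\<dots> = (\<integral>\<^sup>+t. indicator {0<..} t * emeasure M {x. t \<le> H x} \<partial>lborel)"
    by (intro nn_integral_cong, subst nn_integral_cmult) auto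
  finally show ?thesis .
qed

text \<open>For \<open>t > 0\<close> a nonempty level set of \<open>G\<close> is a closed ray from
  some \<open>a \<ge> 0\<close>, with \<open>a\<close> attained by continuity, and the shift moves
  the endpoint to \<open>a + h\<close>. The tail condition thus holds level by level and
  integrates.\<close>

lemma nn_integral_shift_le:
  assumes tail: "\<And>x. 0 \<le> x \<Longrightarrow> measure M {x + h..} \<le> lam * measure M {x..}" and lam: "0 \<le> lam"
    and G: "mono G" "continuous_on UNIV G" "\<And>x. x \<le> 0 \<Longrightarrow> G x = (0::real)"
  shows "(\<integral>\<^sup>+x. ennreal (G (x - h)) \<partial>M) \<le> ennreal lam * (\<integral>\<^sup>+x. ennreal (G x) \<partial>M)"
proof -
  have pos: "0 \<le> G x" for x
    using G(3)[of "min x 0"] monoD[OF G(1), of "min x 0" x] by simp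
  have [measurable]: "G \<in> borel_measurable borel" by (rule borel_measurable_continuous_onI[OF G(2)])
  have level: "emeasure M {x. t \<le> G (x - h)} \<le> ennreal lam * emeasure M {x. t \<le> G x}" if "0 < t" for t
  proof (cases "{x. t \<le> G x} = {}")
    case True
    then have "{x. t \<le> G (x - h)} = {}" by auto
    then show ?thesis by (metis emeasure_empty zero_le)
  next
    case False
    define S where "S = {x. t \<le> G x}"
    define a where "a = Inf S"
    have lb: "0 \<le> x" if "x \<in> S" for x
      using that G(3)[of x] \<open>0 < t\<close> by (cases "x \<le> 0") (auto simp: S_def)
    then have bdd: "bdd_below S" by (auto intro!: bdd_belowI[of _ 0])
    have "closed S" unfolding S_def by (intro closed_Collect_le continuous_on_const G)
    moreover have "S \<noteq> {}" using False by (simp add: S_def)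
    ultimately have a: "a \<in> S" unfolding a_def using bdd by (intro closed_contains_Inf)
    have S: "x \<in> S \<longleftrightarrow> a \<le> x" for x
    proof
      show "a \<le> x" if "x \<in> S" unfolding a_def using that bdd by (rule cInf_lower)
      show "x \<in> S" if "a \<le> x" using a monoD[OF G(1) that] by (simp add: S_def)
    qed
    have G_iff: "t \<le> G x \<longleftrightarrow> a \<le> x" for x using S[of x] unfolding S_def mem_Collect_eq .
    have "{x. t \<le> G x} = {a..}" "{x. t \<le> G (x - h)} = {a + h..}"
      unfolding G_iff by auto
    then show ?thesis
      using tail[OF lb[OF a]] lam by (simp add: emeasure_eq_measure ennreal_leI flip: ennreal_mult)
  qed
  have "(\<integral>\<^sup>+x. ennreal (G (x - h)) \<partial>M)
      = (\<integral>\<^sup>+t. indicator {0<..} t * emeasure M {x. t \<le> G (x - h)} \<partial>lborel)"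
    using pos by (intro nn_integral_layer_cake) auto
  also have "\<dots> \<le> (\<integral>\<^sup>+t. ennreal lam * (indicator {0<..} t * emeasure M {x. t \<le> G x}) \<partial>lborel)"
    using level by (intro nn_integral_mono) (auto simp: indicator_def)
  also have "\<dots> = ennreal lam * (\<integral>\<^sup>+t. indicator {0<..} t * emeasure M {x. t \<le> G x} \<partial>lborel)"
    by (intro nn_integral_cmult) measurable
  also have "(\<integral>\<^sup>+t. indicator {0<..} t * emeasure M {x. t \<le> G x} \<partial>lborel) = (\<integral>\<^sup>+x. ennreal (G x) \<partial>M)"
    using pos by (intro nn_integral_layer_cake[symmetric]) auto
  finally show ?thesis .
qed

lemma integral_shift_le:
  assumes tail: "\<And>x. 0 \<le> x \<Longrightarrow> measure M {x + h..} \<le> lam * measure M {x..}" and lam: "0 \<le> lam" and h: "0 \<le> h"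
    and G: "mono G" "continuous_on UNIV G" "\<And>x. x \<le> 0 \<Longrightarrow> G x = (0::real)" and int: "integrable M G"
  shows "integrable M (\<lambda>x. G (x - h))" "(\<integral>x. G (x - h) \<partial>M) \<le> lam * (\<integral>x. G x \<partial>M)"
proof -
  have pos: "0 \<le> G x" for x
    using G(3)[of "min x 0"] monoD[OF G(1), of "min x 0" x] by simp
  have [measurable]: "G \<in> borel_measurable borel" by (rule borel_measurable_continuous_onI[OF G(2)])
  show int': "integrable M (\<lambda>x. G (x - h))"
    using int by (rule Bochner_Integration.integrable_bound)
      (use pos monoD[OF G(1)] h in auto)
  have "ennreal (\<integral>x. G (x - h) \<partial>M) \<le> ennreal lam * ennreal (\<integral>x. G x \<partial>M)"
    using nn_integral_shift_le[OF tail lam G] pos int int' by (simp add: nn_integral_eq_integral)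
  then show "(\<integral>x. G (x - h) \<partial>M) \<le> lam * (\<integral>x. G x \<partial>M)"
    using pos lam by (simp add: ennreal_le_iff integral_nonneg flip: ennreal_mult)
qed

text \<open>The integral of a truncated exponential is bounded by \<open>exp (h / C) * lam\<close>
  times itself plus a constant. As this factor is below 1, the bound is uniform in the truncation,
  and monotone convergence removes the latter.\<close>

lemma integrable_exp_of_tail:
  assumes tail: "\<And>x. 0 \<le> x \<Longrightarrow> measure M {x + h..} \<le> lam * measure M {x..}" and lam: "0 \<le> lam"
    and h: "0 < h" "0 < C" and r: "exp (h / C) * lam < 1"
  shows "integrable M (\<lambda>x. exp (max x 0 / C))"
proof -
  define r where "r = exp (h / C)"
  \<comment> \<open>Subtracting 1 makes \<open>H n\<close> vanish on the negative half-line, as the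
    shift estimate demands; the cap \<open>real n\<close> secures integrability in advance.\<close>
  define H where "H n x = exp (min (max x 0) (real n) / C) - 1" for n x
  have cont: "continuous_on UNIV (H n)" for n unfolding H_def[abs_def]
    using h by (intro continuous_intros) auto
  then have [measurable]: "H n \<in> borel_measurable borel" for n
    by (rule borel_measurable_continuous_onI)
  have mono: "mono (H n)" for n
    using h by (auto simp: H_def mono_def intro!: divide_right_mono)
  have H0: "H n x = 0" if "x \<le> 0" for n x using that by (simp add: H_def)
  have H_pos: "0 \<le> H n x" for n x using h by (simp add: H_def)
  have H_int: "integrable M (H n)" for n
  proof (rule integrable_const_bound[of _ "exp (real n / C)"])
    have "H n x \<le> exp (real n / C)" for x
    proof -
      have "H n x \<le> exp (min (max x 0) (real n) / C)" by (simp add: H_def)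
      also have "\<dots> \<le> exp (real n / C)" using h by (simp add: divide_right_mono)
      finally show ?thesis .
    qed
    then show "AE x in M. norm (H n x) \<le> exp (real n / C)" using H_pos by simp
  qed simp
  \<comment> \<open>The solution of \<open>J = r * lam * J + (r - 1)\<close>, the equality case of
    the estimate for \<open>H n\<close>.\<close>
  define J where "J = (r - 1) / (1 - r * lam)"
  have J: "(\<integral>x. H n x \<partial>M) \<le> J" for n
  proof -
    note sh = integral_shift_le[OF tail lam less_imp_le[OF h(1)] mono cont H0 H_int, of n]
    have "H n x \<le> r * H n (x - h) + (r - 1)" for x
    proof -
      have "min (max x 0) (real n) / C \<le> (min (max (x - h) 0) (real n) + h) / C"
        using h by (intro divide_right_mono) auto
      then have "exp (min (max x 0) (real n) / C) \<le> exp (min (max (x - h) 0) (real n) / C + h / C)"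
        by (simp add: add_divide_distrib)
      then show ?thesis by (simp add: H_def r_def exp_add algebra_simps)
    qed
    then have "(\<integral>x. H n x \<partial>M) \<le> (\<integral>x. r * H n (x - h) + (r - 1) \<partial>M)"
      using H_int sh by (intro integral_mono) auto
    also have "\<dots> = r * (\<integral>x. H n (x - h) \<partial>M) + (r - 1)"
      using sh by (simp add: prob_UNIV)
    also have "\<dots> \<le> r * (lam * (\<integral>x. H n x \<partial>M)) + (r - 1)"
      using sh by (simp add: r_def)
    finally show ?thesis using r by (simp add: J_def r_def field_simps)
  qed
  have "(\<integral>\<^sup>+x. ennreal (exp (max x 0 / C) - 1) \<partial>M) \<le> (\<integral>\<^sup>+x. (SUP n. ennreal (H n x)) \<partial>M)"
  proof (rule nn_integral_mono)
    fix x
    obtain n where "x \<le> real n" using real_arch_simple by blast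
    then have "exp (max x 0 / C) - 1 = H n x" by (auto simp: H_def)
    then show "ennreal (exp (max x 0 / C) - 1) \<le> (SUP n. ennreal (H n x))"
      by (metis SUP_upper UNIV_I)
  qed
  also have "\<dots> = (SUP n. \<integral>\<^sup>+x. ennreal (H n x) \<partial>M)"
  proof (rule nn_integral_monotone_convergence_SUP)
    show "incseq (\<lambda>n x. ennreal (H n x))"
      using h by (auto simp: incseq_def le_fun_def H_def intro!: ennreal_leI divide_right_mono)
  qed simp
  also have "\<dots> = (SUP n. ennreal (\<integral>x. H n x \<partial>M))"
    using H_int H_pos by (simp add: nn_integral_eq_integral)
  also have "\<dots> \<le> ennreal J" using J by (intro SUP_least ennreal_leI)
  finally have "(\<integral>\<^sup>+x. ennreal (exp (max x 0 / C) - 1) \<partial>M) < \<infinity>"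
    by (rule order_le_less_trans) simp
  then have "integrable M (\<lambda>x. exp (max x 0 / C) - 1)"
    using h by (intro integrableI_nonneg) auto
  then have "integrable M (\<lambda>x. (exp (max x 0 / C) - 1) + 1)" by (intro Bochner_Integration.integrable_add) auto
  then show ?thesis by simp
qed

end

section \<open>The function \<open>2 * (cosh t - 1)\<close> and its increments\<close>

definition cosh_excess :: "real \<Rightarrow> real" where
  "cosh_excess t = exp t + exp (- t) - 2"

lemma cosh_excess_eq: "cosh_excess t = (exp (t / 2) - exp (- t / 2))\<^sup>2"
  by (simp add: cosh_excess_def power2_diff flip: exp_add exp_of_nat_mult)

lemma cosh_excess_nonneg: "0 \<le> cosh_excess t"
  by (simp add: cosh_excess_eq)

text \<open>The function is convex, and this is its tangent inequality at \<open>a\<close>.\<close>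

lemma cosh_excess_diff_le: "cosh_excess a - cosh_excess b \<le> (a - b) * (exp a - exp (- a))"
proof -
  have "exp a * (1 + (b - a)) \<le> exp a * exp (b - a)" by (intro mult_left_mono) auto
  then have 1: "exp a - exp b \<le> (a - b) * exp a" by (simp add: algebra_simps flip: exp_add)
  have "exp (- a) * (1 + (a - b)) \<le> exp (- a) * exp (a - b)" by (intro mult_left_mono) auto
  then have "exp (- a) - exp (- b) \<le> - ((a - b) * exp (- a))" by (simp add: algebra_simps flip: exp_add)
  with 1 show ?thesis by (simp add: cosh_excess_def algebra_simps)
qed

lemma cosh_excess_mono:
  assumes "0 \<le> b" "b \<le> a"
  shows "cosh_excess b \<le> cosh_excess a"
proof -
  have "(b - a) * (exp b - exp (- b)) \<le> 0" using assms by (intro mult_nonpos_nonneg) auto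
  then show ?thesis using cosh_excess_diff_le[of b a] by linarith
qed

text \<open>The derivative \<open>exp a - exp (- a)\<close> is \<open>2 sinh (a / 2)\<close> times
  \<open>2 cosh (a / 2)\<close>. Young's inequality with weight \<open>\<delta>\<close> splits off a
  small multiple of \<open>cosh_excess a\<close>, to be absorbed later, from the squared
  increment.\<close>

lemma cosh_excess_diff_le_quadratic:
  fixes a b \<delta> :: real
  assumes "0 \<le> b" "b \<le> a" "0 < \<delta>"
  shows "cosh_excess a - cosh_excess b \<le> \<delta> / 2 * cosh_excess a + 2 / \<delta> * ((a - b)\<^sup>2 * exp a)"
proof -
  define r where "r = exp (a / 2)"
  define g where "g = exp (a / 2) - exp (- a / 2)"
  have g: "0 \<le> g" using assms by (simp add: g_def)
  have "exp a - exp (- a) = g * (exp (a / 2) + exp (- a / 2))"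
    by (simp add: g_def algebra_simps flip: exp_add)
  also have "\<dots> \<le> g * (2 * r)" using g assms by (intro mult_left_mono) (auto simp: r_def)
  finally have "(a - b) * (exp a - exp (- a)) \<le> (a - b) * (g * (2 * r))"
    using assms by (intro mult_left_mono) auto
  also have "\<dots> = (2 * (\<delta> * g) * (2 * ((a - b) * r))) / (2 * \<delta>)" using assms by simp
  also have "\<dots> \<le> ((\<delta> * g)\<^sup>2 + (2 * ((a - b) * r))\<^sup>2) / (2 * \<delta>)"
    using assms sum_squares_bound[of "\<delta> * g" "2 * ((a - b) * r)"] by (intro divide_right_mono) auto
  also have "\<dots> = \<delta> / 2 * g\<^sup>2 + 2 / \<delta> * ((a - b)\<^sup>2 * r\<^sup>2)"
    using assms by (simp add: field_simps power2_eq_square)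
  also have "g\<^sup>2 = cosh_excess a" by (simp add: g_def cosh_excess_eq)
  also have "r\<^sup>2 = exp a" by (simp add: r_def power2_eq_square flip: exp_add)
  finally show ?thesis using cosh_excess_diff_le[of a b] by linarith
qed

context real_distribution
begin

text \<open>By the shift estimate, the integral of the increment over a step \<open>h\<close> keeps
  at least the fraction \<open>1 - lam\<close> of the full integral. Half of that fraction absorbs
  the first term of the quadratic bound.\<close>

lemma integral_cosh_excess_le:
  assumes tail: "\<And>x. 0 \<le> x \<Longrightarrow> measure M {x + h..} \<le> lam * measure M {x..}"
    and lam: "0 \<le> lam" "lam < 1" and h: "0 \<le> h"
    and u: "mono u" "\<And>x. x \<le> 0 \<Longrightarrow> u x = (0::real)" "\<And>x y. \<bar>u y - u x\<bar> \<le> L * \<bar>y - x\<bar>"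
    and int: "integrable M (\<lambda>x. exp (u x))"
  shows "integrable M (\<lambda>x. cosh_excess (u x))"
    and "integrable M (\<lambda>x. (u x - u (x - h))\<^sup>2 * exp (u x))"
    and "(\<integral>x. cosh_excess (u x) \<partial>M) \<le> 4 / (1 - lam)\<^sup>2 * (\<integral>x. (u x - u (x - h))\<^sup>2 * exp (u x) \<partial>M)"
proof -
  define \<delta> where "\<delta> = 1 - lam"
  have \<delta>: "0 < \<delta>" using lam by (simp add: \<delta>_def)
  have cont: "continuous_on UNIV u" by (rule continuous_on_of_lipschitz[OF u(3)])
  have [measurable]: "u \<in> borel_measurable borel" by (rule borel_measurable_of_lipschitz[OF u(3)])
  have pos: "0 \<le> u x" for x
    using u(2)[of "min x 0"] monoD[OF u(1), of "min x 0" x] by simp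
  have [measurable]: "(\<lambda>x. cosh_excess (u x)) \<in> borel_measurable borel"
    by (simp add: cosh_excess_def)
  show s_int: "integrable M (\<lambda>x. cosh_excess (u x))"
  proof (rule Bochner_Integration.integrable_bound[OF int])
    have "exp (- u x) \<le> 1" for x using pos[of x] by simp
    then have "cosh_excess (u x) \<le> exp (u x)" for x
      unfolding cosh_excess_def by (smt (verit))
    then show "AE x in M. norm (cosh_excess (u x)) \<le> norm (exp (u x))"
      by (simp add: cosh_excess_nonneg)
  qed simp
  show D_int: "integrable M (\<lambda>x. (u x - u (x - h))\<^sup>2 * exp (u x))"
  proof (rule Bochner_Integration.integrable_bound)
    show "integrable M (\<lambda>x. (L * h)\<^sup>2 * exp (u x))" using int by simp
    have "\<bar>u x - u (x - h)\<bar> \<le> \<bar>L * h\<bar>" for x using u(3)[of x "x - h"] h by simp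
    then have "(u x - u (x - h))\<^sup>2 \<le> (L * h)\<^sup>2" for x by (simp only: abs_le_square_iff)
    then show "AE x in M. norm ((u x - u (x - h))\<^sup>2 * exp (u x)) \<le> norm ((L * h)\<^sup>2 * exp (u x))"
      by (simp add: abs_mult)
  qed simp
  define S X where "S = (\<integral>x. cosh_excess (u x) \<partial>M)"
    and "X = (\<integral>x. (u x - u (x - h))\<^sup>2 * exp (u x) \<partial>M)"
  have "mono (\<lambda>x. cosh_excess (u x))"
    by (rule monoI) (intro cosh_excess_mono pos monoD[OF u(1)])
  moreover have "continuous_on UNIV (\<lambda>x. cosh_excess (u x))"
    unfolding cosh_excess_def by (intro continuous_intros cont)
  moreover have "cosh_excess (u x) = 0" if "x \<le> 0" for x
    using u(2)[OF that] by (simp add: cosh_excess_def)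
  ultimately have sh: "integrable M (\<lambda>x. cosh_excess (u (x - h)))"
    "(\<integral>x. cosh_excess (u (x - h)) \<partial>M) \<le> lam * S"
    unfolding S_def using integral_shift_le[OF tail lam(1) h, where G = "\<lambda>x. cosh_excess (u x)"] s_int by auto
  have "S - lam * S \<le> (\<integral>x. cosh_excess (u x) - cosh_excess (u (x - h)) \<partial>M)"
    using s_int sh by (simp add: S_def)
  also have "\<dots> \<le> (\<integral>x. \<delta> / 2 * cosh_excess (u x) + 2 / \<delta> * ((u x - u (x - h))\<^sup>2 * exp (u x)) \<partial>M)"
    using s_int sh D_int \<delta> pos h monoD[OF u(1)]
    by (intro integral_mono cosh_excess_diff_le_quadratic) auto
  also have "\<dots> = \<delta> / 2 * S + 2 / \<delta> * X"
    using s_int D_int by (simp add: S_def X_def)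
  finally have "\<delta> / 2 * S \<le> 2 / \<delta> * X"
    using arg_cong[OF \<delta>_def, of "\<lambda>d. d * S"] unfolding left_diff_distrib by linarith
  then have "S \<le> 4 / \<delta>\<^sup>2 * X" using \<delta> by (simp add: field_simps power2_eq_square)
  then show "(\<integral>x. cosh_excess (u x) \<partial>M) \<le> 4 / (1 - lam)\<^sup>2 * (\<integral>x. (u x - u (x - h))\<^sup>2 * exp (u x) \<partial>M)"
    by (simp add: S_def X_def \<delta>_def)
qed

end

lemma exp_minus_le_linear:
  fixes y :: real
  assumes "0 \<le> y" "y \<le> 1"
  shows "exp (- y) \<le> 1 - y / 2"
proof -
  have "y * y \<le> y" using assms by (simp add: mult_left_le)
  then have "1 \<le> (1 - y / 2) * (1 + y)" by (simp add: algebra_simps)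
  also have "\<dots> \<le> (1 - y / 2) * exp y" using assms by (intro mult_left_mono) auto
  finally show ?thesis by (simp add: exp_minus field_simps)
qed

text \<open>The sign \<open>\<sigma>\<close> selects the ray, so that both half-lines are treated at once.\<close>

definition ray_part :: "(real \<Rightarrow> real) \<Rightarrow> real \<Rightarrow> real \<Rightarrow> real" where
  "ray_part g \<sigma> x = max 0 (g (\<sigma> * max x 0))"

lemma ray_part_nonpos: "g 0 = 0 \<Longrightarrow> x \<le> 0 \<Longrightarrow> ray_part g \<sigma> x = 0"
  by (simp add: ray_part_def max_absorb2)

text \<open>Along the ray \<open>g\<close> may dip below 0 before rising. The chord from the origin
  bounds the nearer value by a fraction of the farther one, and positive parts remove the
  dip.\<close>

lemma mono_ray_part:
  assumes g: "convex_on UNIV g" "g 0 = 0"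
  shows "mono (ray_part g \<sigma>)"
proof (rule monoI)
  fix x y :: real assume "x \<le> y"
  define a b where "a = max x 0" and "b = max y 0"
  have ab: "0 \<le> a" "a \<le> b" using \<open>x \<le> y\<close> by (auto simp: a_def b_def)
  have "g (\<sigma> * a) \<le> max 0 (g (\<sigma> * b))"
  proof (cases "b = 0")
    case False
    have t: "0 \<le> a / b" "a / b \<le> 1" using ab False by auto
    have "g (\<sigma> * a) \<le> a / b * g (\<sigma> * b)"
      using convex_on_chord[OF g(1) t, of 0 "\<sigma> * b"] False g(2) by (simp add: mult.commute)
    also have "\<dots> \<le> a / b * max 0 (g (\<sigma> * b))" using t by (intro mult_left_mono) auto
    also have "\<dots> \<le> 1 * max 0 (g (\<sigma> * b))" using t by (intro mult_right_mono) auto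
    finally show ?thesis by simp
  qed (use ab g in auto)
  then show "ray_part g \<sigma> x \<le> ray_part g \<sigma> y" by (simp add: ray_part_def a_def b_def)
qed

lemma ray_part_lipschitz:
  assumes lip: "\<And>x y. \<bar>g y - g x\<bar> \<le> L * \<bar>y - x\<bar>" and "\<bar>\<sigma>\<bar> = 1"
  shows "\<bar>ray_part g \<sigma> y - ray_part g \<sigma> x\<bar> \<le> L * \<bar>y - x\<bar>"
proof -
  have L: "0 \<le> L" using order_trans[OF abs_ge_zero lip[of 1 0]] by simp
  have "\<bar>ray_part g \<sigma> y - ray_part g \<sigma> x\<bar> \<le> \<bar>g (\<sigma> * max y 0) - g (\<sigma> * max x 0)\<bar>"
    by (auto simp: ray_part_def max_def)
  also have "\<dots> \<le> L * \<bar>\<sigma> * max y 0 - \<sigma> * max x 0\<bar>" by (rule lip)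
  also have "\<bar>\<sigma> * max y 0 - \<sigma> * max x 0\<bar> = \<bar>max y 0 - max x 0\<bar>"
    using assms(2) by (simp flip: right_diff_distrib add: abs_mult)
  also have "L * \<dots> \<le> L * \<bar>y - x\<bar>" using L by (intro mult_left_mono) auto
  finally show ?thesis .
qed

context real_distribution
begin

section \<open>Reflection invariance of a symmetric measure\<close>

lemma distr_uminus_of_symmetric:
  assumes "symmetric_measure M"
  shows "distr M borel uminus = M"
proof (rule measure_eqI)
  fix A assume "A \<in> sets (distr M borel uminus)"
  then have A: "A \<in> sets borel" by simp
  have "uminus -` A = uminus ` A" by (auto simp: image_iff intro!: bexI[of _ "- x" for x])
  then have "emeasure (distr M borel uminus) A = emeasure M (uminus ` A)"
    using A by (simp add: emeasure_distr)
  then show "emeasure (distr M borel uminus) A = emeasure M A"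
    using assms A by (simp add: emeasure_eq_measure symmetric_measure_def)
qed simp

lemma integral_reflect_of_symmetric:
  fixes k :: "real \<Rightarrow> real"
  assumes "symmetric_measure M" and k: "integrable M k"
  shows "integrable M (\<lambda>x. k (- x))" "(\<integral>x. k (- x) \<partial>M) = (\<integral>x. k x \<partial>M)"
proof -
  have km: "k \<in> borel_measurable borel" using borel_measurable_integrable[OF k] by simp
  note d = distr_uminus_of_symmetric[OF assms(1)]
  show "integrable M (\<lambda>x. k (- x))"
    using integrable_distr_eq[of uminus M borel k] km k d by simp
  show "(\<integral>x. k (- x) \<partial>M) = (\<integral>x. k x \<partial>M)"
    using integral_distr[of uminus M borel k] km d by simp
qed

lemma convex_tau_of_in_class_M:
  assumes "in_class_M M h lam"
  shows "convex_tau M (17 * h / (1 - lam)\<^sup>2)"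
  unfolding convex_tau_def
proof (intro allI impI, elim conjE)
  fix f :: "real \<Rightarrow> real" assume f: "convex_on UNIV f" and "bdd_below (range f)"
  then obtain b where b: "\<And>y. b \<le> f y" by (auto simp: bdd_below_def)
  have h: "0 < h" and lam: "0 \<le> lam" "lam < 1" and sym: "symmetric_measure M"
    and tail: "\<And>x. 0 \<le> x \<Longrightarrow> measure M {x + h..} \<le> lam * measure M {x..}"
    using assms by (auto simp: in_class_M_def)
  define \<delta> where "\<delta> = 1 - lam"
  have \<delta>: "0 < \<delta>" "\<delta> \<le> 1" using lam by (auto simp: \<delta>_def)
  have \<delta>2: "0 < \<delta>\<^sup>2" "\<delta>\<^sup>2 \<le> 1" using \<delta> by (simp_all add: power_le_one)
  have \<delta>3: "\<delta>\<^sup>2 \<le> \<delta>" using \<delta> by (simp add: power2_eq_square mult_left_le)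
  \<comment> \<open>The 17 makes \<open>c\<close> below at least
    \<open>16 / \<delta>\<^sup>2\<close>. Linearising the exponential halves this to
    \<open>8 / \<delta>\<^sup>2\<close>, twice the \<open>4 / \<delta>\<^sup>2\<close> of the ray
    estimate, because each ray is charged twice.\<close>
  define C where "C = 17 * h / \<delta>\<^sup>2"
  have C: "0 < C" using h \<delta> by (simp add: C_def)
  have hC: "h / C = \<delta>\<^sup>2 / 17" "C / h = 17 / \<delta>\<^sup>2" using h \<delta> by (auto simp: C_def)
  define c where "c = C / h - 1 / 2"
  have c: "16 / \<delta>\<^sup>2 \<le> c" "c \<le> 17 / \<delta>\<^sup>2" "0 \<le> c"
  proof -
    have "1 / 1 \<le> 1 / \<delta>\<^sup>2" using \<delta>2 by (intro divide_left_mono) auto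
    then show "16 / \<delta>\<^sup>2 \<le> c" "c \<le> 17 / \<delta>\<^sup>2" "0 \<le> c" by (auto simp: c_def hC)
  qed
  define Q where "Q = inf_conv f (\<lambda>z. \<bar>z\<bar> / C)"
  define a where "a = Q 0"
  define g where "g x = Q x - a" for x
  have g0: "g 0 = 0" by (simp add: g_def a_def)
  have "convex_on UNIV Q"
    unfolding Q_def using f b C by (intro convex_on_inf_conv[of f b] convex_on_abs_div) auto
  then have "convex_on UNIV (\<lambda>x. Q x + - a)" by (intro convex_on_add) (auto simp: convex_on_const)
  then have g: "convex_on UNIV g" by (simp add: g_def[abs_def])
  have g_lip: "\<bar>g y - g x\<bar> \<le> (1 / C) * \<bar>y - x\<bar>" for x y
    using inf_conv_abs_lipschitz[of b f C y x] b C by (simp add: g_def Q_def)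
  have [measurable]: "g \<in> borel_measurable borel" by (rule borel_measurable_of_lipschitz[OF g_lip])
  have g_reflect: "- g x \<le> g (- x)" for x
    using convex_on_chord[OF g, of "1/2" x "-2 * x"] g0 by simp
  have Q_le: "Q x \<le> f x" for x
    using inf_conv_lower[of b f "\<lambda>z. \<bar>z\<bar> / C" x x] b C by (simp add: Q_def)

  define U where "U = ray_part g"
  define D where "D \<sigma> x = U \<sigma> x - U \<sigma> (x - h)" for \<sigma> x
  have U0: "U \<sigma> x = 0" if "x \<le> 0" for \<sigma> x
    using ray_part_nonpos[of g x] g0 that by (simp add: U_def)
  have U_mono: "mono (U \<sigma>)" for \<sigma> unfolding U_def by (rule mono_ray_part[OF g g0])
  have U_lip: "\<bar>U \<sigma> y - U \<sigma> x\<bar> \<le> (1 / C) * \<bar>y - x\<bar>" if "\<bar>\<sigma>\<bar> = 1" for \<sigma> x y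
    unfolding U_def by (rule ray_part_lipschitz[OF g_lip that])
  have U_pos: "0 \<le> U \<sigma> x" for \<sigma> x by (simp add: U_def ray_part_def)
  have D_pos: "0 \<le> D \<sigma> x" for \<sigma> x using monoD[OF U_mono, of "x - h" x] h by (simp add: D_def)
  have D0: "D \<sigma> x = 0" if "x \<le> 0" for \<sigma> x using that h by (simp add: D_def U0)
  have D_le: "D \<sigma> x \<le> h / C" if "\<bar>\<sigma>\<bar> = 1" for \<sigma> x
    using U_lip[OF that, of x "x - h"] h D_pos[of \<sigma> x] by (simp add: D_def)

  have descent: "inf_conv f (\<lambda>z. phi0 (z / C)) (\<sigma> * x) \<le> a + g (\<sigma> * x) - c * (D \<sigma> x)\<^sup>2"
    if \<sigma>: "\<bar>\<sigma>\<bar> = 1" and x: "0 \<le> x" for \<sigma> x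
  proof (cases "D \<sigma> x = 0")
    case True
    then show ?thesis
      using inf_conv_phi0_descent[OF f b h C Q_def, of "\<sigma> * x" "\<sigma> * x" 0] h C by (simp add: g_def)
  next
    case False
    then have "0 < D \<sigma> x" using D_pos[of \<sigma> x] by simp
    then have "0 < U \<sigma> x" using U_pos[of \<sigma> "x - h"] by (simp add: D_def)
    then have "U \<sigma> x = g (\<sigma> * x)" using x by (auto simp: U_def ray_part_def max_def split: if_splits)
    \<comment> \<open>Replacing \<open>U\<close> by \<open>g\<close> at the nearer point only
      increases the drop, since \<open>U\<close> is a positive part. The target is clipped at the
      origin so that it stays on the ray.\<close>
    then have "D \<sigma> x \<le> Q (\<sigma> * x) - Q (\<sigma> * max (x - h) 0)"
      by (simp add: D_def U_def ray_part_def g_def)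
    moreover have "\<bar>\<sigma> * x - \<sigma> * max (x - h) 0\<bar> \<le> h"
      using \<sigma> x h by (simp flip: right_diff_distrib add: abs_mult)
    ultimately show ?thesis
      using inf_conv_phi0_descent[OF f b h C Q_def, of "\<sigma> * x" "\<sigma> * max (x - h) 0" "D \<sigma> x"]
        D_pos[of \<sigma> x] D_le[OF \<sigma>, of x]
      by (simp add: g_def c_def)
  qed

  have pointwise: "exp (g (\<sigma> * x) - c * (D \<sigma> x)\<^sup>2) + exp (- g (\<sigma> * x)) - 2
      \<le> cosh_excess (U \<sigma> x) + cosh_excess (U (- \<sigma>) x) - 8 / \<delta>\<^sup>2 * ((D \<sigma> x)\<^sup>2 * exp (U \<sigma> x))"
    if \<sigma>: "\<bar>\<sigma>\<bar> = 1" and x: "0 \<le> x" for \<sigma> x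
  proof (cases "0 < g (\<sigma> * x)")
    case True
    then have U: "U \<sigma> x = g (\<sigma> * x)" using x by (simp add: U_def ray_part_def)
    define y where "y = c * (D \<sigma> x)\<^sup>2"
    \<comment> \<open>So \<open>y\<close> is at most \<open>\<delta>\<^sup>2 / 17\<close>, within
      the range where \<open>exp (- y) \<le> 1 - y / 2\<close>.\<close>
    have "y \<le> 17 / \<delta>\<^sup>2 * (\<delta>\<^sup>2 / 17)\<^sup>2"
      unfolding y_def using c D_pos[of \<sigma> x] D_le[OF \<sigma>, of x] hC by (intro mult_mono power_mono) auto
    also have "\<dots> \<le> 1" using \<delta> \<delta>2 by (simp add: power2_eq_square)
    finally have "exp (- y) \<le> 1 - y / 2" using c by (intro exp_minus_le_linear) (auto simp: y_def)
    moreover have "8 / \<delta>\<^sup>2 * (D \<sigma> x)\<^sup>2 \<le> y / 2"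
      unfolding y_def using mult_right_mono[OF c(1), of "(D \<sigma> x)\<^sup>2"] by simp
    ultimately have "exp (- y) \<le> 1 - 8 / \<delta>\<^sup>2 * (D \<sigma> x)\<^sup>2" by simp
    then have "exp (g (\<sigma> * x)) * exp (- y) \<le> exp (g (\<sigma> * x)) * (1 - 8 / \<delta>\<^sup>2 * (D \<sigma> x)\<^sup>2)"
      by (intro mult_left_mono) auto
    then have "exp (g (\<sigma> * x) - y) \<le> exp (g (\<sigma> * x)) - 8 / \<delta>\<^sup>2 * ((D \<sigma> x)\<^sup>2 * exp (g (\<sigma> * x)))"
      by (simp add: algebra_simps flip: exp_add)
    then show ?thesis
      using cosh_excess_nonneg[of "U (- \<sigma>) x"] unfolding U y_def cosh_excess_def[of "g (\<sigma> * x)"] by linarith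
  next
    case False
    then have U: "U \<sigma> x = 0" using x by (simp add: U_def ray_part_def)
    then have D: "D \<sigma> x = 0" using D_pos[of \<sigma> x] U_pos[of \<sigma> "x - h"] by (simp add: D_def)
    \<comment> \<open>Here \<open>- g\<close> is nonnegative and at most the value of
      \<open>g\<close> at the reflected point, so the cost is moved to the opposite ray.\<close>
    have "cosh_excess (- g (\<sigma> * x)) \<le> cosh_excess (U (- \<sigma>) x)"
      using False g_reflect[of "\<sigma> * x"] x by (intro cosh_excess_mono) (auto simp: U_def ray_part_def)
    then show ?thesis by (simp add: U D cosh_excess_def)
  qed

  have r: "exp (h / C) * lam < 1"
  proof -
    \<comment> \<open>As \<open>h / C = \<delta>\<^sup>2 / 17 < \<delta>\<close>, functions of
      Lipschitz constant \<open>1 / C\<close> grow too slowly for their exponentials to outrun the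
      tail decay.\<close>
    have "lam < 1 - h / C" using \<delta>3 \<delta> by (simp add: hC \<delta>_def)
    also have "\<dots> \<le> exp (- (h / C))" using exp_ge_add_one_self[of "- (h / C)"] by simp
    finally show ?thesis by (simp add: exp_minus field_simps)
  qed
  have U_meas [measurable]: "U \<sigma> \<in> borel_measurable borel" if "\<bar>\<sigma>\<bar> = 1" for \<sigma>
    by (rule borel_measurable_of_lipschitz[OF U_lip[OF that]])
  have exp_int: "integrable M (\<lambda>x. exp (U \<sigma> x))" if \<sigma>: "\<bar>\<sigma>\<bar> = 1" for \<sigma>
  proof (rule Bochner_Integration.integrable_bound[OF integrable_exp_of_tail[OF tail lam(1) h C r]])
    have "U \<sigma> x \<le> max x 0 / C" for x
      using U_lip[OF \<sigma>, of x 0] U0[of x \<sigma>] U0[of 0 \<sigma>] U_pos[of \<sigma> x] by (cases "x \<le> 0") auto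
    then show "AE x in M. norm (exp (U \<sigma> x)) \<le> norm (exp (max x 0 / C))" by simp
  qed (use \<sigma> in measurable)
  have ray: "integrable M (\<lambda>x. cosh_excess (U \<sigma> x))" "integrable M (\<lambda>x. (D \<sigma> x)\<^sup>2 * exp (U \<sigma> x))"
    "(\<integral>x. cosh_excess (U \<sigma> x) \<partial>M) \<le> 4 / \<delta>\<^sup>2 * (\<integral>x. (D \<sigma> x)\<^sup>2 * exp (U \<sigma> x) \<partial>M)"
    if \<sigma>: "\<bar>\<sigma>\<bar> = 1" for \<sigma>
    unfolding D_def \<delta>_def
    by (rule integral_cosh_excess_le[where h = h and lam = lam and L = "1 / C"];
        use tail lam h U_mono U0 U_lip[OF \<sigma>] exp_int[OF \<sigma>] in simp)+
  define X S where "X \<sigma> = (\<integral>x. (D \<sigma> x)\<^sup>2 * exp (U \<sigma> x) \<partial>M)"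
    and "S \<sigma> = (\<integral>x. cosh_excess (U \<sigma> x) \<partial>M)" for \<sigma>
  have SX: "S \<sigma> \<le> 4 / \<delta>\<^sup>2 * X \<sigma>" if "\<bar>\<sigma>\<bar> = 1" for \<sigma>
    using ray(3)[OF that] by (simp add: S_def X_def)
  have s_int: "integrable M (\<lambda>x. cosh_excess (U 1 x))" "integrable M (\<lambda>x. cosh_excess (U (-1) x))"
    using ray(1)[of 1] ray(1)[of "-1"] by auto
  have d_int: "integrable M (\<lambda>x. (D 1 x)\<^sup>2 * exp (U 1 x))" "integrable M (\<lambda>x. (D (-1) x)\<^sup>2 * exp (U (-1) x))"
    using ray(2)[of 1] ray(2)[of "-1"] by auto
  note reflect = integral_reflect_of_symmetric[OF sym]

  \<comment> \<open>At each \<open>x\<close> only one of the two terms can be nonzero, since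
    \<open>D\<close> vanishes on the nonpositive half-line. \<open>R\<close> joins the two rays in
    the same way.\<close>
  define E where "E x = c * (D 1 x)\<^sup>2 + c * (D (-1) (- x))\<^sup>2" for x
  define R where "R x = 2 + (cosh_excess (U 1 x) + cosh_excess (U (-1) x))
      + (cosh_excess (U 1 (- x)) + cosh_excess (U (-1) (- x)))
      - 8 / \<delta>\<^sup>2 * ((D 1 x)\<^sup>2 * exp (U 1 x) + (D (-1) (- x))\<^sup>2 * exp (U (-1) (- x)))" for x
  have [measurable]: "U 1 \<in> borel_measurable borel" "U (-1) \<in> borel_measurable borel"
    by (auto intro: U_meas)
  have [measurable]: "E \<in> borel_measurable borel" by (simp add: E_def[abs_def] D_def)
  have s00: "cosh_excess 0 = 0" by (simp add: cosh_excess_def)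
  have inf_le: "inf_conv f (\<lambda>z. phi0 (z / C)) x \<le> a + (g x - E x)" for x
    using descent[of 1 x] descent[of "-1" "- x"] by (cases "0 \<le> x") (auto simp: E_def D0)
  have le_R: "exp (g x - E x) + exp (- g x) \<le> R x" for x
    using pointwise[of 1 x] pointwise[of "-1" "- x"]
    by (cases "0 \<le> x") (auto simp: E_def R_def D0 U0 s00)
  have R_int: "integrable M R"
    unfolding R_def[abs_def] using s_int d_int reflect(1)[OF s_int(1)] reflect(1)[OF s_int(2)] reflect(1)[OF d_int(2)]
    by simp
  \<comment> \<open>Reflection preserves the integrals, so each \<open>S\<close> occurs twice and
    each \<open>X\<close> once.\<close>
  have "(\<integral>x. R x \<partial>M) = 2 + (S 1 + S (-1)) + (S 1 + S (-1)) - 8 / \<delta>\<^sup>2 * (X 1 + X (-1))"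
    unfolding R_def S_def X_def using s_int d_int reflect[OF s_int(1)] reflect[OF s_int(2)] reflect[OF d_int(2)]
    by (simp add: prob_UNIV)
  also have "8 / \<delta>\<^sup>2 * (X 1 + X (-1)) = 2 * (4 / \<delta>\<^sup>2 * X 1) + 2 * (4 / \<delta>\<^sup>2 * X (-1))"
    by (simp add: algebra_simps add_divide_distrib)
  also have "2 + (S 1 + S (-1)) + (S 1 + S (-1)) - \<dots> \<le> 2" using SX[of 1] SX[of "-1"] by simp
  finally have R2: "(\<integral>x. R x \<partial>M) \<le> 2" .
  have int1: "integrable M (\<lambda>x. exp (g x - E x))"
  proof (rule Bochner_Integration.integrable_bound[OF R_int])
    have "exp (g x - E x) \<le> R x" for x using le_R[of x] exp_gt_zero[of "- g x"] by linarith
    then show "AE x in M. norm (exp (g x - E x)) \<le> norm (R x)" by (auto intro!: AE_I2 order_trans[OF _ abs_ge_self])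
  qed simp
  have int2: "integrable M (\<lambda>x. exp (- g x))"
  proof (rule Bochner_Integration.integrable_bound[OF R_int])
    have "exp (- g x) \<le> R x" for x using le_R[of x] exp_gt_zero[of "g x - E x"] by linarith
    then show "AE x in M. norm (exp (- g x)) \<le> norm (R x)" by (auto intro!: AE_I2 order_trans[OF _ abs_ge_self])
  qed simp
  define A B where "A = (\<integral>x. exp (g x - E x) \<partial>M)" and "B = (\<integral>x. exp (- g x) \<partial>M)"
  have AB0: "0 \<le> A" "0 \<le> B" by (simp_all add: A_def B_def)
  have "A + B = (\<integral>x. exp (g x - E x) + exp (- g x) \<partial>M)" using int1 int2 by (simp add: A_def B_def)
  also have "\<dots> \<le> (\<integral>x. R x \<partial>M)" using int1 int2 R_int le_R by (intro integral_mono) auto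
  finally have "A + B \<le> 2" using R2 by simp
  then have "(A + B)\<^sup>2 \<le> 2\<^sup>2" using AB0 by (intro power_mono) auto
  moreover have "4 * (A * B) \<le> (A + B)\<^sup>2"
    using sum_squares_bound[of A B] by (simp add: power2_sum)
  ultimately have AB: "A * B \<le> 1" by simp

  have 1: "(\<integral>\<^sup>+x. ennreal (exp (inf_conv f (\<lambda>z. phi0 (z / C)) x)) \<partial>M) \<le> ennreal (exp a * A)"
  proof -
    have "(\<integral>\<^sup>+x. ennreal (exp (inf_conv f (\<lambda>z. phi0 (z / C)) x)) \<partial>M) \<le> (\<integral>\<^sup>+x. ennreal (exp a * exp (g x - E x)) \<partial>M)"
      using inf_le by (intro nn_integral_mono ennreal_leI) (simp flip: exp_add)
    also have "\<dots> = ennreal (exp a * A)"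
      unfolding A_def using int1 by (subst nn_integral_eq_integral) auto
    finally show ?thesis .
  qed
  have 2: "(\<integral>\<^sup>+x. ennreal (exp (- f x)) \<partial>M) \<le> ennreal (exp (- a) * B)"
  proof -
    have "(\<integral>\<^sup>+x. ennreal (exp (- f x)) \<partial>M) \<le> (\<integral>\<^sup>+x. ennreal (exp (- a) * exp (- g x)) \<partial>M)"
      using Q_le by (intro nn_integral_mono ennreal_leI) (simp add: g_def flip: exp_add)
    also have "\<dots> = ennreal (exp (- a) * B)"
      unfolding B_def using int2 by (subst nn_integral_eq_integral) auto
    finally show ?thesis .
  qed
  \<comment> \<open>The normalising factors \<open>exp a\<close> and \<open>exp (- a)\<close> cancel
    in the product.\<close>
  have "(\<integral>\<^sup>+x. ennreal (exp (inf_conv f (\<lambda>z. phi0 (z / C)) x)) \<partial>M) * (\<integral>\<^sup>+x. ennreal (exp (- f x)) \<partial>M)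
      \<le> ennreal (exp a * A) * ennreal (exp (- a) * B)"
    using 1 2 by (intro mult_mono) auto
  also have "\<dots> = ennreal (A * B)"
    using AB0 by (simp add: exp_minus field_simps flip: ennreal_mult)
  also have "\<dots> \<le> 1" using AB by simp
  finally show "(\<integral>\<^sup>+x. ennreal (exp (inf_conv f (\<lambda>z. phi0 (z / (17 * h / (1 - lam)\<^sup>2))) x)) \<partial>M)
      * (\<integral>\<^sup>+x. ennreal (exp (- f x)) \<partial>M) \<le> 1"
    by (simp add: C_def \<delta>_def)
qed

end

theorem theorem1p1:
  fixes \<mu> :: "real measure"
  assumes "prob_space \<mu>" and "sets \<mu> = sets borel" and "symmetric_measure \<mu>"
  shows "((\<exists>h lam. h > 0 \<and> 0 \<le> lam \<and> lam < 1 \<and> in_class_M \<mu> h lam)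
            \<longleftrightarrow> (\<exists>Cp>0. convex_poincare \<mu> Cp))
       \<and> ((\<exists>Cp>0. convex_poincare \<mu> Cp) \<longleftrightarrow> (\<exists>Ct>0. convex_tau \<mu> Ct))
       \<and> (\<forall>h lam. h > 0 \<and> 0 \<le> lam \<and> lam < 1 \<and> in_class_M \<mu> h lam
            \<longrightarrow> convex_tau \<mu> (17 * h / (1 - lam)\<^sup>2))
       \<and> (\<forall>Ct>0. convex_tau \<mu> Ct \<longrightarrow> convex_poincare \<mu> (Ct\<^sup>2 / 2))
       \<and> (\<forall>Cp>0. convex_poincare \<mu> Cp \<longrightarrow> in_class_M \<mu> (sqrt (8 * Cp)) (1 / 2))"
proof -
  interpret prob_space \<mu> by fact
  interpret real_distribution \<mu> by unfold_locales (use assms in \<open>auto dest: sets_eq_imp_space_eq\<close>)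
  have tau: "convex_tau \<mu> (17 * h / (1 - lam)\<^sup>2)" "0 < 17 * h / (1 - lam)\<^sup>2"
    if "in_class_M \<mu> h lam" for h lam
    using convex_tau_of_in_class_M[OF that] that by (auto simp: in_class_M_def)
  have poincare: "convex_poincare \<mu> (Ct\<^sup>2 / 2)" "0 < Ct\<^sup>2 / 2" if "0 < Ct" "convex_tau \<mu> Ct" for Ct
    using convex_poincare_of_convex_tau[OF that] that by auto
  have tails: "in_class_M \<mu> (sqrt (8 * Cp)) (1 / 2)" if "0 < Cp" "convex_poincare \<mu> Cp" for Cp
    using in_class_M_of_convex_poincare[OF assms(3) that] .
  \<comment> \<open>The implications from tails to tau, from tau to Poincare and from Poincare to
    tails close a cycle, which gives both equivalences.\<close>
  have "\<exists>h lam. h > 0 \<and> 0 \<le> lam \<and> lam < 1 \<and> in_class_M \<mu> h lam" if "\<exists>Cp>0. convex_poincare \<mu> Cp"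
    using that tails unfolding in_class_M_def by blast
  moreover have "\<exists>Ct>0. convex_tau \<mu> Ct"
    if "\<exists>h lam. h > 0 \<and> 0 \<le> lam \<and> lam < 1 \<and> in_class_M \<mu> h lam"
    using that tau by blast
  moreover have "\<exists>Cp>0. convex_poincare \<mu> Cp" if "\<exists>Ct>0. convex_tau \<mu> Ct"
    using that poincare by blast
  ultimately show ?thesis using tau(1) poincare(1) tails by blast
qed

end
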